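(* Assume that the true solution $(\mathbf u,\Psi)$ of the unsteady Brinkman problem described in the context, with $\boldsymbol\sigma=-\frac{\nu}{\phi}\nabla\mathbf u$, is sufficiently smooth in time. Let $(\boldsymbol\sigma^{n+1},\tilde{\mathbf u}^{n+1},\mathbf u^{n+1},\Psi^{n+1},\mathbf q^{n+1})$, $0\le n\le N-1$, be the solution of the semi-discrete (continuous-in-space) projection method described in the context, with time step $\Delta t=\mathcal T/N$. Then there exists a constant $C$ independent of $\Delta t$ such that $$ \begin{aligned} &\Delta t\sum_{n=0}^{N-1}\nu^{-1}\|\phi^{1/2}(\boldsymbol\sigma(t_{n+1})-\boldsymbol\sigma^{n+1})\|^2+\|\phi^{-1/2}(\mathbf u(t_N)-\mathbf u^N)\|^2+\Delta t^2\|\phi^{1/2}(\nabla\Psi(t_N)-\mathbf q^N)\|^2\\ &\qquad+\Delta t\sum_{n=0}^{N-1}\left(\|\mathbf L^{1/2}(\mathbf u(t_{n+1})-\mathbf u^{n+1})\|^2+\|\mathbf L^{1/2}(\mathbf u(t_{n+1})-\tilde{\mathbf u}^{n+1})\|^2\right)\ \le\ C\,\Delta t^2. \end{aligned} $$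
   Context: Setting. $\Omega\subset\mathbf R^d$, $d\in\{2,3\}$, is a bounded domain with boundary $\Gamma$ and outward unit normal $\mathbf n$. $\mathcal T>0$ is the final time, $N\ge1$ an integer, $\Delta t=\mathcal T/N$, $t_n=n\Delta t$. $(\cdot,\cdot)$ and $\|\cdot\|$ are the $L^2(\Omega)$ inner product and norm for scalar, vector or tensor functions. $\nu>0$ is a constant. The porosity $\phi>0$ is time-independent and piecewise constant on a finite simplicial partition of $\Omega$. $\mathbf K=\mathbf K(x)$ is a time-independent symmetric positive definite $d\times d$ permeability tensor, $\mathfrak K=\mathbf K^{-1}$, $\mathbf L=\nu\mathfrak K$, assumed bounded on $\Omega$; $\mathbf L^{1/2}$ is its pointwise symmetric positive definite square root. $\mathbf V=H(\mathrm{div},\Omega)$, $W=L^2(\Omega)$, $\mathbf V_0=\{\mathbf v\in\mathbf V:\mathbf v\cdot\mathbf n=0\text{ on }\Gamma\}$, $W_0=\{w\in W:\int_\Omega w=0\}$. $(\mathbf V)^d$ denotes tensor functions with each row in $\mathbf V$; the divergence of a tensor is row-wise. Brinkman problem. Find the velocity $\mathbf u$ and kinematic pressure $\Psi$ with $$\nabla\cdot\mathbf u=0,\qquad \frac1\phi\frac{\partial\mathbf u}{\partial t}+\nabla\Psi-\nabla\cdot\left(\frac\nu\phi\nabla\mathbf u\right)+\mathbf L\mathbf u=0\quad\text{in }\Omega\times(0,\mathcal T],$$ with $\mathbf u=0$ on $\Gamma$ for all $t\in[0,\mathcal T]$, $\mathbf u(0)=\mathbf u_0$ (where $\nabla\cdot\mathbf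 u_0=0$), $\Psi(0)=\Psi_0$, and $\Psi(t)\in W_0$. The true solution, with $\boldsymbol\sigma=-\frac\nu\phi\nabla\mathbf u\in(\mathbf V)^d$ and $\nabla\Psi\in(L^2(\Omega))^d$, satisfies these equations at each $t_{n+1}$ in the mixed form $$\left(\tfrac\phi\nu\boldsymbol\sigma(t_{n+1}),\boldsymbol\tau\right)-(\mathbf u(t_{n+1}),\nabla\cdot\boldsymbol\tau)=0\quad\forall\boldsymbol\tau\in(\mathbf V)^d,$$ $$\left(\tfrac1\phi\tfrac{\partial\mathbf u}{\partial t}(t_{n+1}),\boldsymbol\xi\right)+(\nabla\cdot\boldsymbol\sigma(t_{n+1}),\boldsymbol\xi)+(\nabla\Psi(t_{n+1}),\boldsymbol\xi)+(\mathbf L\mathbf u(t_{n+1}),\boldsymbol\xi)=0\quad\forall\boldsymbol\xi\in(W)^d,$$ $$\nabla\cdot\mathbf u(t_{n+1})=0.$$ "Sufficiently smooth in time" is understood as: $\mathbf u\in C^2([0,\mathcal T];(L^2(\Omega))^d)$ and $\nabla\Psi\in C^1([0,\mathcal T];(L^2(\Omega))^d)$. Semi-discrete method. Set $\mathbf u^0=\mathbf u_0$, $\Psi^0=\Psi_0$, $\mathbf q^0=\nabla\Psi_0$. For $0\le n\le N-1$: (1) Predictor problem: find $\boldsymbol\sigma^{n+1}\in(\mathbf V)^d$ and $\tilde{\mathbf u}^{n+1}\in(W)^d$ such that $$\left(\tfrac\phi\nu\boldsymbol\sigma^{n+1},\boldsymbol\tau\right)-(\tilde{\mathbf u}^{n+1},\nabla\cdot\boldsymbol\tau)=0\quad\forall\boldsymbol\tau\in(\mathbf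 V)^d,$$ $$\left(\tfrac1\phi\tfrac{\tilde{\mathbf u}^{n+1}-\mathbf u^n}{\Delta t},\boldsymbol\xi\right)+(\nabla\cdot\boldsymbol\sigma^{n+1},\boldsymbol\xi)+(\mathbf q^n,\boldsymbol\xi)+(\mathbf L\tilde{\mathbf u}^{n+1},\boldsymbol\xi)=0\quad\forall\boldsymbol\xi\in(W)^d.$$ (2) Projection problem: find $\mathbf u^{n+1}\in\mathbf V_0$ and $\Psi^{n+1}\in W_0$ such that $$\left(\tfrac1\phi\tfrac{\mathbf u^{n+1}-\tilde{\mathbf u}^{n+1}}{\Delta t},\mathbf v\right)+(\mathbf L(\mathbf u^{n+1}-\tilde{\mathbf u}^{n+1}),\mathbf v)-(\Psi^{n+1}-\Psi^n,\nabla\cdot\mathbf v)=0\quad\forall\mathbf v\in\mathbf V_0,$$ $$(\nabla\cdot\mathbf u^{n+1},w)=0\quad\forall w\in W_0.$$ (3) Pressure gradient update: find $\mathbf q^{n+1}\in(W)^d$ such that $$(\mathbf q^{n+1},\boldsymbol\xi)=(\mathbf q^n,\boldsymbol\xi)-\left(\tfrac1\phi\tfrac{\mathbf u^{n+1}-\tilde{\mathbf u}^{n+1}}{\Delta t},\boldsymbol\xi\right)-(\mathbf L(\mathbf u^{n+1}-\tilde{\mathbf u}^{n+1}),\boldsymbol\xi)\quad\forall\boldsymbol\xi\in(W)^d.$$ *)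

theory Defs
  imports "HOL-Analysis.Analysis"
begin

text \<open>Scalar, vector and tensor fields are functions with values in \<open>real\<close>, \<open>real ^ 'd\<close> and
  \<open>real ^ 'd ^ 'd\<close>, identified up to null sets. The inner product on the last type is the
  Frobenius product, and \<open>\<tau> x $ i\<close> is the \<open>i\<close>-th row of \<open>\<tau> x\<close>.\<close>

definition L2 :: "(real ^ 'd) set \<Rightarrow> (real ^ 'd \<Rightarrow> 'b::euclidean_space) set" where
  "L2 \<Omega> = {f. f \<in> borel_measurable (lebesgue_on \<Omega>) \<and>
             integrable (lebesgue_on \<Omega>) (\<lambda>x. (norm (f x))\<^sup>2)}"

definition L2_inner :: "(real ^ 'd) set \<Rightarrow> (real ^ 'd \<Rightarrow> 'b::euclidean_space) \<Rightarrow>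
    (real ^ 'd \<Rightarrow> 'b) \<Rightarrow> real" where
  "L2_inner \<Omega> f g = (LINT x|lebesgue_on \<Omega>. f x \<bullet> g x)"

definition L2_norm :: "(real ^ 'd) set \<Rightarrow> (real ^ 'd \<Rightarrow> 'b::euclidean_space) \<Rightarrow> real" where
  "L2_norm \<Omega> f = sqrt (L2_inner \<Omega> f f)"

definition W0 :: "(real ^ 'd) set \<Rightarrow> (real ^ 'd \<Rightarrow> real) set" where
  "W0 \<Omega> = {w \<in> L2 \<Omega>. (LINT x|lebesgue_on \<Omega>. w x) = 0}"

primrec Ck :: "nat \<Rightarrow> (real ^ 'd \<Rightarrow> real) \<Rightarrow> bool" where
  "Ck 0 f \<longleftrightarrow> continuous_on UNIV f"
| "Ck (Suc k) f \<longleftrightarrow> (\<exists>D. (\<forall>x. GDERIV f x :> D x) \<and> (\<forall>i. Ck k (\<lambda>x. D x $ i)))"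

definition test_functions :: "(real ^ 'd) set \<Rightarrow> (real ^ 'd \<Rightarrow> real) set" where
  "test_functions \<Omega> = {f. (\<forall>k. Ck k f) \<and> compact (closure {x. f x \<noteq> 0}) \<and>
                          closure {x. f x \<noteq> 0} \<subseteq> \<Omega>}"

definition grad :: "(real ^ 'd \<Rightarrow> real) \<Rightarrow> real ^ 'd \<Rightarrow> real ^ 'd" where
  "grad f x = (THE D. GDERIV f x :> D)"

text \<open>Weak derivatives are unique only up to null sets, so they are expressed as relations:
  \<open>has_grad \<Omega> w G\<close> says that \<open>w \<in> H\<^sup>1(\<Omega>)\<close> with \<open>\<nabla>w = G\<close>, and \<open>has_div \<Omega> v g\<close> says that
  \<open>v \<in> H(div, \<Omega>)\<close> with \<open>\<nabla>\<cdot>v = g\<close>.\<close>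

definition has_grad :: "(real ^ 'd) set \<Rightarrow> (real ^ 'd \<Rightarrow> real) \<Rightarrow>
    (real ^ 'd \<Rightarrow> real ^ 'd) \<Rightarrow> bool" where
  "has_grad \<Omega> w G \<longleftrightarrow> w \<in> L2 \<Omega> \<and> G \<in> L2 \<Omega> \<and>
     (\<forall>f\<in>test_functions \<Omega>. \<forall>i.
        L2_inner \<Omega> w (\<lambda>x. grad f x $ i) = - L2_inner \<Omega> (\<lambda>x. G x $ i) f)"

definition has_div :: "(real ^ 'd) set \<Rightarrow> (real ^ 'd \<Rightarrow> real ^ 'd) \<Rightarrow>
    (real ^ 'd \<Rightarrow> real) \<Rightarrow> bool" where
  "has_div \<Omega> v g \<longleftrightarrow> v \<in> L2 \<Omega> \<and> g \<in> L2 \<Omega> \<and>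
     (\<forall>f\<in>test_functions \<Omega>. L2_inner \<Omega> v (grad f) = - L2_inner \<Omega> g f)"

text \<open>Row-wise divergence of a tensor field in \<open>H(div, \<Omega>)\<^sup>d\<close>.\<close>

definition has_tensor_div :: "(real ^ 'd) set \<Rightarrow> (real ^ 'd \<Rightarrow> real ^ 'd ^ 'd) \<Rightarrow>
    (real ^ 'd \<Rightarrow> real ^ 'd) \<Rightarrow> bool" where
  "has_tensor_div \<Omega> \<tau> s \<longleftrightarrow> (\<forall>i. has_div \<Omega> (\<lambda>x. \<tau> x $ i) (\<lambda>x. s x $ i))"

text \<open>\<open>v \<in> V\<^sub>0\<close> with \<open>\<nabla>\<cdot>v = g\<close>. The normal trace of a field in \<open>H(div, \<Omega>)\<close> is the functional
  \<open>w \<mapsto> (v, \<nabla>w) + (\<nabla>\<cdot>v, w)\<close> on (traces of) \<open>w \<in> H\<^sup>1(\<Omega>)\<close>; by Green's formula it is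
  \<open>\<integral>\<^sub>\<Gamma> (v\<cdot>n) w\<close> with the outward unit normal \<open>n\<close> when \<open>v\<close> is smooth.\<close>

definition has_div0 :: "(real ^ 'd) set \<Rightarrow> (real ^ 'd \<Rightarrow> real ^ 'd) \<Rightarrow>
    (real ^ 'd \<Rightarrow> real) \<Rightarrow> bool" where
  "has_div0 \<Omega> v g \<longleftrightarrow> has_div \<Omega> v g \<and>
     (\<forall>w G. has_grad \<Omega> w G \<longrightarrow> L2_inner \<Omega> v G + L2_inner \<Omega> g w = 0)"

text \<open>\<open>w \<in> H\<^sup>1\<^sub>0(\<Omega>)\<close> (the closure of the test functions in \<open>H\<^sup>1(\<Omega>)\<close>, i.e. zero trace on \<open>\<Gamma>\<close>)
  with \<open>\<nabla>w = G\<close>.\<close>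

definition has_grad0 :: "(real ^ 'd) set \<Rightarrow> (real ^ 'd \<Rightarrow> real) \<Rightarrow>
    (real ^ 'd \<Rightarrow> real ^ 'd) \<Rightarrow> bool" where
  "has_grad0 \<Omega> w G \<longleftrightarrow> has_grad \<Omega> w G \<and>
     (\<exists>f. (\<forall>k::nat. f k \<in> test_functions \<Omega>) \<and>
          (\<lambda>k. L2_norm \<Omega> (\<lambda>x. f k x - w x)) \<longlonglongrightarrow> 0 \<and>
          (\<lambda>k. L2_norm \<Omega> (\<lambda>x. grad (f k) x - G x)) \<longlonglongrightarrow> 0)"

text \<open>The entry \<open>G x $ i $ j\<close> is \<open>\<partial>\<^sub>j u\<^sub>i\<close>, so \<open>\<nabla>\<cdot>u\<close> is the trace of \<open>G\<close>.\<close>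

definition has_vector_grad0 :: "(real ^ 'd) set \<Rightarrow> (real ^ 'd \<Rightarrow> real ^ 'd) \<Rightarrow>
    (real ^ 'd \<Rightarrow> real ^ 'd ^ 'd) \<Rightarrow> bool" where
  "has_vector_grad0 \<Omega> u G \<longleftrightarrow> (\<forall>i. has_grad0 \<Omega> (\<lambda>x. u x $ i) (\<lambda>x. G x $ i))"

definition L2_continuous :: "(real ^ 'd) set \<Rightarrow> real \<Rightarrow>
    (real \<Rightarrow> real ^ 'd \<Rightarrow> 'b::euclidean_space) \<Rightarrow> bool" where
  "L2_continuous \<Omega> T f \<longleftrightarrow> (\<forall>t\<in>{0..T}. f t \<in> L2 \<Omega> \<and>
     ((\<lambda>s. L2_norm \<Omega> (\<lambda>x. f s x - f t x)) \<longlongrightarrow> 0) (at t within {0..T}))"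

text \<open>\<open>f \<in> C\<^sup>1([0,T]; L\<^sup>2(\<Omega>))\<close> with time derivative \<open>f'\<close>.\<close>

definition L2_C1 :: "(real ^ 'd) set \<Rightarrow> real \<Rightarrow>
    (real \<Rightarrow> real ^ 'd \<Rightarrow> 'b::euclidean_space) \<Rightarrow> (real \<Rightarrow> real ^ 'd \<Rightarrow> 'b) \<Rightarrow> bool" where
  "L2_C1 \<Omega> T f f' \<longleftrightarrow> L2_continuous \<Omega> T f \<and> L2_continuous \<Omega> T f' \<and>
     (\<forall>t\<in>{0..T}. ((\<lambda>s. L2_norm \<Omega> (\<lambda>x. (f s x - f t x) /\<^sub>R (s - t) - f' t x)) \<longlongrightarrow> 0)
        (at t within {0..T}))"

definition simplicial_partition :: "(real ^ 'd) set set \<Rightarrow> (real ^ 'd) set \<Rightarrow> bool" where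
  "simplicial_partition M \<Omega> \<longleftrightarrow> finite M \<and> (\<forall>S\<in>M. int CARD('d) simplex S) \<and>
     pairwise (\<lambda>S S'. interior S \<inter> interior S' = {}) M \<and> \<Union>M = closure \<Omega>"

definition piecewise_constant :: "(real ^ 'd) set set \<Rightarrow> (real ^ 'd) set \<Rightarrow>
    (real ^ 'd \<Rightarrow> real) \<Rightarrow> bool" where
  "piecewise_constant M \<Omega> f \<longleftrightarrow> (\<forall>S\<in>M. f constant_on (interior S \<inter> \<Omega>))"

definition spd :: "real ^ 'd ^ 'd \<Rightarrow> bool" where
  "spd A \<longleftrightarrow> transpose A = A \<and> (\<forall>v. v \<noteq> 0 \<longrightarrow> 0 < v \<bullet> (A *v v))"

definition drag :: "real \<Rightarrow> (real ^ 'd \<Rightarrow> real ^ 'd ^ 'd) \<Rightarrow> real ^ 'd \<Rightarrow> real ^ 'd ^ 'd" where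
  "drag \<nu> K x = \<nu> *\<^sub>R matrix_inv (K x)"

text \<open>Here \<open>ut\<close>, \<open>gu\<close>, \<open>d\<sigma>\<close>, \<open>g\<Psi>\<close> stand for \<open>\<partial>u/\<partial>t\<close>, \<open>\<nabla>u\<close>, \<open>\<nabla>\<cdot>\<sigma>\<close>, \<open>\<nabla>\<Psi>\<close>. That \<open>ut\<close> is the time
  derivative of \<open>u\<close> is not part of this predicate; it is expressed with \<open>L2_C1\<close>.
  The boundary condition and the constraint \<open>\<nabla>\<cdot>u = 0\<close> include \<open>t = 0\<close>, where the latter is
  \<open>\<nabla>\<cdot>u\<^sub>0 = 0\<close>.\<close>

definition brinkman_solution where
  "brinkman_solution \<Omega> \<nu> \<phi> L T u0 \<Psi>0 u ut gu \<sigma> d\<sigma> \<Psi> g\<Psi> \<longleftrightarrow>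
     (\<forall>t\<in>{0..T}. has_vector_grad0 \<Omega> (u t) (gu t) \<and>
        (AE x in lebesgue_on \<Omega>. trace (gu t x) = 0) \<and>
        \<Psi> t \<in> W0 \<Omega> \<and> has_grad \<Omega> (\<Psi> t) (g\<Psi> t)) \<and>
     (\<forall>t\<in>{0<..T}.
        (AE x in lebesgue_on \<Omega>. \<sigma> t x = - (\<nu> / \<phi> x) *\<^sub>R gu t x) \<and>
        has_tensor_div \<Omega> (\<sigma> t) (d\<sigma> t) \<and>
        (AE x in lebesgue_on \<Omega>.
           (1 / \<phi> x) *\<^sub>R ut t x + g\<Psi> t x + d\<sigma> t x + L x *v u t x = 0)) \<and>
     (AE x in lebesgue_on \<Omega>. u 0 x = u0 x) \<and>
     (AE x in lebesgue_on \<Omega>. \<Psi> 0 x = \<Psi>0 x)"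

text \<open>One time step of size \<open>dt\<close>: \<open>un, \<Psi>n, qn\<close> are the old values, \<open>us\<close> is the predicted
  velocity and \<open>\<sigma>1, u1, \<Psi>1, q1\<close> are the new values.\<close>

definition predictor where
  "predictor \<Omega> \<nu> \<phi> L dt un qn \<sigma>1 us \<longleftrightarrow> us \<in> L2 \<Omega> \<and>
     (\<exists>s. has_tensor_div \<Omega> \<sigma>1 s \<and>
       (\<forall>\<tau> r. has_tensor_div \<Omega> \<tau> r \<longrightarrow>
          L2_inner \<Omega> (\<lambda>x. (\<phi> x / \<nu>) *\<^sub>R \<sigma>1 x) \<tau> - L2_inner \<Omega> us r = 0) \<and>
       (\<forall>\<xi>\<in>L2 \<Omega>.
          L2_inner \<Omega> (\<lambda>x. (1 / \<phi> x) *\<^sub>R ((us x - un x) /\<^sub>R dt)) \<xi> + L2_inner \<Omega> s \<xi>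
          + L2_inner \<Omega> qn \<xi> + L2_inner \<Omega> (\<lambda>x. L x *v us x) \<xi> = 0))"

definition projection where
  "projection \<Omega> \<phi> L dt \<Psi>n us u1 \<Psi>1 \<longleftrightarrow>
     (\<exists>g. has_div0 \<Omega> u1 g \<and> (\<forall>w\<in>W0 \<Omega>. L2_inner \<Omega> g w = 0)) \<and> \<Psi>1 \<in> W0 \<Omega> \<and>
     (\<forall>v h. has_div0 \<Omega> v h \<longrightarrow>
        L2_inner \<Omega> (\<lambda>x. (1 / \<phi> x) *\<^sub>R ((u1 x - us x) /\<^sub>R dt)) v
        + L2_inner \<Omega> (\<lambda>x. L x *v (u1 x - us x)) v
        - L2_inner \<Omega> (\<lambda>x. \<Psi>1 x - \<Psi>n x) h = 0)"

definition gradient_update where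
  "gradient_update \<Omega> \<phi> L dt us u1 qn q1 \<longleftrightarrow> q1 \<in> L2 \<Omega> \<and>
     (\<forall>\<xi>\<in>L2 \<Omega>. L2_inner \<Omega> q1 \<xi> = L2_inner \<Omega> qn \<xi>
        - L2_inner \<Omega> (\<lambda>x. (1 / \<phi> x) *\<^sub>R ((u1 x - us x) /\<^sub>R dt)) \<xi>
        - L2_inner \<Omega> (\<lambda>x. L x *v (u1 x - us x)) \<xi>)"

text \<open>The sequences \<open>\<sigma>h, us, uh, \<Psi>h, qh\<close> are indexed by the time level; \<open>\<sigma>h 0\<close> and \<open>us 0\<close> are
  not used.\<close>

definition semi_discrete_solution where
  "semi_discrete_solution \<Omega> \<nu> \<phi> L dt N u0 \<Psi>0 g\<Psi>0 \<sigma>h us uh \<Psi>h qh \<longleftrightarrow>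
     (AE x in lebesgue_on \<Omega>. uh 0 x = u0 x) \<and>
     (AE x in lebesgue_on \<Omega>. \<Psi>h 0 x = \<Psi>0 x) \<and>
     (AE x in lebesgue_on \<Omega>. qh 0 x = g\<Psi>0 x) \<and>
     (\<forall>n::nat. n < N \<longrightarrow>
        predictor \<Omega> \<nu> \<phi> L dt (uh n) (qh n) (\<sigma>h (Suc n)) (us (Suc n)) \<and>
        projection \<Omega> \<phi> L dt (\<Psi>h n) (us (Suc n)) (uh (Suc n)) (\<Psi>h (Suc n)) \<and>
        gradient_update \<Omega> \<phi> L dt (us (Suc n)) (uh (Suc n)) (qh n) (qh (Suc n)))"

end

theory Submission
  imports Defs
begin

text \<open>
  Write \<open>e\<close>, \<open>e*\<close>, \<open>p\<close> for the errors in the corrected velocity, the predicted velocity and the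
  pressure gradient, \<open>A = 1/\<phi>\<close>, \<open>h = \<Delta>t\<close> and \<open>M = A + h L\<close>. The gradient update holds pointwise as
  \<open>M e\<^sup>n\<^sup>+\<^sup>1 + h p\<^sup>n\<^sup>+\<^sup>1 = M e* + h p\<^sup>n + h d\<close>, where \<open>d\<close> is the increment of the exact pressure gradient.
  Taking squares in the norm of \<open>M\<^sup>-\<^sup>1\<close> and using \<open>(e\<^sup>n\<^sup>+\<^sup>1, p\<^sup>n\<^sup>+\<^sup>1) = 0\<close>, the cross term \<open>2h (e*, p\<^sup>n)\<close> is
  the one that appears when the predictor error equation is tested with \<open>2h e*\<close>, so it cancels; \<open>(d, e*)\<close>
  cancels as well and only the Taylor remainder \<open>R\<close> of \<open>\<partial>u/\<partial>t\<close> is paired with \<open>e*\<close>. The energy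
  \<open>(A e, e) + h\<^sup>2 (M\<^sup>-\<^sup>1 p, p)\<close> then grows by at most a factor \<open>1 + h\<close> and a term \<open>O(h\<^sup>3)\<close> per step, and
  Gronwall's lemma gives the estimate.
\<close>

section \<open>Measurability and the space \<open>L\<^sup>2\<close>\<close>

text \<open>With the weight of \<open>M\<close> inverse, the square of \<open>M e + h p\<close> is
  the sum of \<open>(M e, e)\<close>, \<open>2h (e, p)\<close> and the weighted square of
  \<open>h p\<close>. The cross term carries no coefficient, so it vanishes by orthogonality
  although \<phi> and \<open>L\<close> vary in space. Write \<open>et\<close> for the predicted
  error and \<open>e'\<close> for the new one. Testing the predictor with \<open>2h et\<close>
  supplies \<open>2h (L et, et)\<close>. Half of it is spent on the drag part of
  \<open>(M et, et)\<close>; the other half and the \<open>h (L e', e')\<close> inside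
  \<open>(M e', e')\<close> become the two drag sums of the estimate. The remainder \<open>R\<close>
  is paired with \<open>et\<close>, which is not part of the energy. Splitting
  \<open>et = (et - e) + e\<close>, the first part is absorbed by the dissipation
  \<open>(A (et - e), et - e)\<close> of the backward difference, and the second adds to the growth
  factor. Since \<open>M\<close> is bounded below by \<open>A\<close> and above uniformly for
  \<open>h \<le> T\<close>, its inverse is comparable with \<phi> independently of \<open>h\<close>.
  All weights are local, so the algebra is done pointwise; only the orthogonality and the predictor
  identity require integration.\<close>

lemma borel_measurable_vec_nth:
  fixes f :: "'a \<Rightarrow> 'b::euclidean_space ^ 'n"
  assumes "f \<in> borel_measurable M"
  shows "(\<lambda>x. f x $ i) \<in> borel_measurable M"
proof -
  have "continuous_on UNIV (\<lambda>v::'b ^ 'n. v $ i)"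
    by (intro continuous_intros)
  then show ?thesis
    using assms borel_measurable_continuous_on by blast
qed

lemma borel_measurable_vecI:
  fixes f :: "'a \<Rightarrow> 'b::euclidean_space ^ 'n"
  assumes "\<And>i. (\<lambda>x. f x $ i) \<in> borel_measurable M"
  shows "f \<in> borel_measurable M"
proof (subst borel_measurable_euclidean_space, rule ballI)
  fix c :: "'b ^ 'n" assume "c \<in> Basis"
  then obtain i b where "c = axis i b"
    by (auto simp: Basis_vec_def)
  then show "(\<lambda>x. f x \<bullet> c) \<in> borel_measurable M"
    using assms by (simp add: inner_axis)
qed

lemma borel_measurable_matrix_vector:
  fixes A :: "'a \<Rightarrow> real ^ 'n ^ 'm"
  assumes "A \<in> borel_measurable M" "f \<in> borel_measurable M"
  shows "(\<lambda>x. A x *v f x) \<in> borel_measurable M"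
proof (rule borel_measurable_vecI)
  fix i
  have "(\<lambda>x. A x $ i \<bullet> f x) \<in> borel_measurable M"
    using assms borel_measurable_vec_nth by (intro borel_measurable_inner) auto
  then show "(\<lambda>x. (A x *v f x) $ i) \<in> borel_measurable M"
    by (simp add: matrix_vector_mul_component)
qed

lemma borel_measurable_det:
  fixes A :: "'a \<Rightarrow> real ^ 'n ^ 'n"
  assumes "\<And>i j. (\<lambda>x. A x $ i $ j) \<in> borel_measurable M"
  shows "(\<lambda>x. det (A x)) \<in> borel_measurable M"
  unfolding det_def using assms
  by (intro borel_measurable_sum borel_measurable_times borel_measurable_prod borel_measurable_const)

lemma matrix_inv_mult:
  fixes A :: "'a::field ^ 'n ^ 'n"
  assumes "invertible A"
  shows "A ** matrix_inv A = mat 1" "matrix_inv A ** A = mat 1"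
proof -
  have "A ** matrix_inv A = mat 1 \<and> matrix_inv A ** A = mat 1"
    unfolding matrix_inv_def by (rule someI_ex) (use assms in \<open>simp add: invertible_def\<close>)
  then show "A ** matrix_inv A = mat 1" "matrix_inv A ** A = mat 1" by auto
qed

text \<open>Cramer's rule for \<open>A *v y = axis l 1\<close>, whose solution is the
  \<open>l\<close>-th column of the inverse. Quotients of determinants of measurable entries are
  measurable, hence so is the inverse of a measurable matrix field.\<close>

lemma matrix_inv_component:
  fixes A :: "'a::field ^ 'n ^ 'n"
  assumes "invertible A"
  shows "matrix_inv A $ k $ l = det (\<chi> i j. if j = k then axis l 1 $ i else A $ i $ j) / det A"
proof -
  have "A *v (matrix_inv A *v axis l 1) = axis l 1"
    using matrix_inv_mult[OF assms] by (simp add: matrix_vector_mul_assoc)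
  then have "matrix_inv A *v axis l 1 =
      (\<chi> k. det (\<chi> i j. if j = k then axis l 1 $ i else A $ i $ j) / det A)"
    using assms by (subst (asm) cramer) (auto simp: invertible_det_nz)
  moreover have "(matrix_inv A *v axis l 1) $ k = matrix_inv A $ k $ l"
    by (simp add: matrix_vector_mult_def axis_def if_distrib[where f="\<lambda>z. _ * z"] cong: if_cong)
  ultimately show ?thesis by simp
qed

lemma borel_measurable_matrix_inv:
  fixes A :: "'a \<Rightarrow> real ^ 'n ^ 'n"
  assumes A: "A \<in> borel_measurable M" and inv: "\<And>x. x \<in> space M \<Longrightarrow> invertible (A x)"
  shows "(\<lambda>x. matrix_inv (A x)) \<in> borel_measurable M"
proof (intro borel_measurable_vecI)
  fix k l
  have m: "(\<lambda>x. A x $ i $ j) \<in> borel_measurable M" for i j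
    using A by (intro borel_measurable_vec_nth)
  have "(\<lambda>x. det (\<chi> i j. if j = k then axis l 1 $ i else A x $ i $ j) / det (A x))
      \<in> borel_measurable M"
  proof (intro borel_measurable_divide borel_measurable_det)
    show "(\<lambda>x. (\<chi> i j. if j = k then axis l 1 $ i else A x $ i $ j) $ i $ j)
        \<in> borel_measurable M" for i j
      using m by (cases "j = k") auto
  qed (rule m)
  then show "(\<lambda>x. matrix_inv (A x) $ k $ l) \<in> borel_measurable M"
    by (rule subst[OF measurable_cong, rotated])
      (simp add: matrix_inv_component inv)
qed

text \<open>Extension by zero moves the claim to the complete measure \<open>lebesgue\<close>, where
  changes on null sets preserve measurability.\<close>

lemma borel_measurable_lebesgue_on_AE:
  fixes f g :: "'a::euclidean_space \<Rightarrow> 'b::euclidean_space"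
  assumes S: "S \<in> sets lebesgue" and f: "f \<in> borel_measurable (lebesgue_on S)"
    and ae: "AE x in lebesgue_on S. f x = g x"
  shows "g \<in> borel_measurable (lebesgue_on S)"
proof -
  have "(\<lambda>x. if x \<in> S then f x else 0) \<in> borel_measurable lebesgue"
    using borel_measurable_if[OF S] f by blast
  moreover have "AE x in lebesgue. (if x \<in> S then f x else 0) = (if x \<in> S then g x else 0)"
    using ae S by (subst (asm) AE_restrict_space_iff) (auto elim: eventually_mono)
  ultimately have "(\<lambda>x. if x \<in> S then g x else 0) \<in> borel_measurable lebesgue"
    by (rule borel_measurable_AE)
  then show ?thesis
    using borel_measurable_if[OF S] by blast
qed

section \<open>The semi-definite form on square integrable fields\<close>

lemma L2_measurable: "f \<in> L2 \<Omega> \<Longrightarrow> f \<in> borel_measurable (lebesgue_on \<Omega>)"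
  by (simp add: L2_def)

lemma L2_integrable: "f \<in> L2 \<Omega> \<Longrightarrow> integrable (lebesgue_on \<Omega>) (\<lambda>x. (norm (f x))\<^sup>2)"
  by (simp add: L2_def)

text \<open>The value spaces of \<open>f\<close> and \<open>g\<close> may differ, so one criterion
  covers components, matrix products, bounded multipliers and continuous functions on bounded
  sets.\<close>

lemma L2_dominated:
  fixes f :: "real ^ 'd \<Rightarrow> 'b::euclidean_space" and g :: "real ^ 'd \<Rightarrow> 'c::euclidean_space"
  assumes "f \<in> L2 \<Omega>" "g \<in> borel_measurable (lebesgue_on \<Omega>)"
    and "AE x in lebesgue_on \<Omega>. norm (g x) \<le> c * norm (f x)"
  shows "g \<in> L2 \<Omega>"
proof -
  have "integrable (lebesgue_on \<Omega>) (\<lambda>x. (norm (g x))\<^sup>2)"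
  proof (rule Bochner_Integration.integrable_bound)
    show "integrable (lebesgue_on \<Omega>) (\<lambda>x. c\<^sup>2 * (norm (f x))\<^sup>2)"
      using L2_integrable[OF assms(1)] by simp
    show "AE x in lebesgue_on \<Omega>. norm ((norm (g x))\<^sup>2) \<le> norm (c\<^sup>2 * (norm (f x))\<^sup>2)"
      using assms(3)
    proof eventually_elim
      case (elim x)
      then have "(norm (g x))\<^sup>2 \<le> (c * norm (f x))\<^sup>2" by (intro power_mono) auto
      then show ?case by (simp add: power_mult_distrib)
    qed
  qed (use assms(2) in measurable)
  then show ?thesis using assms(2) by (simp add: L2_def)
qed

lemma L2_AE_cong:
  assumes "\<Omega> \<in> sets lebesgue" "f \<in> L2 \<Omega>" "AE x in lebesgue_on \<Omega>. f x = g x"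
  shows "g \<in> L2 \<Omega>"
proof (rule L2_dominated[OF assms(2)])
  show "g \<in> borel_measurable (lebesgue_on \<Omega>)"
    using borel_measurable_lebesgue_on_AE[OF assms(1)] L2_measurable assms(2,3) by blast
  show "AE x in lebesgue_on \<Omega>. norm (g x) \<le> 1 * norm (f x)"
    using assms(3) by (auto elim: eventually_mono)
qed

lemma L2_const: "\<Omega> \<in> lmeasurable \<Longrightarrow> (\<lambda>x. c) \<in> L2 \<Omega>"
  by (simp add: L2_def finite_measure_lebesgue_on finite_measure.integrable_const)

lemma L2_scaleR: "f \<in> L2 \<Omega> \<Longrightarrow> (\<lambda>x. c *\<^sub>R f x) \<in> L2 \<Omega>"
  by (rule L2_dominated[where c="\<bar>c\<bar>"]) (auto simp: L2_def)

lemma L2_mult_bounded: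
  fixes f :: "real ^ 'd \<Rightarrow> 'b::euclidean_space"
  assumes "f \<in> L2 \<Omega>" "h \<in> borel_measurable (lebesgue_on \<Omega>)" "AE x in lebesgue_on \<Omega>. \<bar>h x\<bar> \<le> c"
  shows "(\<lambda>x. h x *\<^sub>R f x) \<in> L2 \<Omega>"
  using assms(2,3) L2_measurable[OF assms(1)]
  by (intro L2_dominated[OF assms(1), where c=c])
    (auto elim!: eventually_mono intro!: mult_right_mono)

lemma L2_matrix_bounded:
  fixes f :: "real ^ 'd \<Rightarrow> real ^ 'n" and A :: "real ^ 'd \<Rightarrow> real ^ 'n ^ 'm"
  assumes "f \<in> L2 \<Omega>" "A \<in> borel_measurable (lebesgue_on \<Omega>)"
    "AE x in lebesgue_on \<Omega>. \<forall>v. norm (A x *v v) \<le> c * norm v"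
  shows "(\<lambda>x. A x *v f x) \<in> L2 \<Omega>"
  using assms(2,3) L2_measurable[OF assms(1)]
  by (intro L2_dominated[OF assms(1), where c=c])
    (auto elim!: eventually_mono intro!: borel_measurable_matrix_vector)

lemma L2_vec_nth:
  fixes f :: "real ^ 'd \<Rightarrow> 'b::euclidean_space ^ 'n"
  assumes "f \<in> L2 \<Omega>"
  shows "(\<lambda>x. f x $ i) \<in> L2 \<Omega>"
  by (rule L2_dominated[OF assms, where c=1])
    (use assms in \<open>auto simp: L2_def intro: borel_measurable_vec_nth Finite_Cartesian_Product.norm_nth_le\<close>)

lemma norm_vec_squared: "(norm (v :: 'b::real_normed_vector ^ 'n))\<^sup>2 = (\<Sum>i\<in>UNIV. (norm (v $ i))\<^sup>2)"
  by (simp add: norm_vec_def L2_set_def sum_nonneg)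

lemma L2_vecI:
  fixes f :: "real ^ 'd \<Rightarrow> 'b::euclidean_space ^ 'n"
  assumes "\<And>i. (\<lambda>x. f x $ i) \<in> L2 \<Omega>"
  shows "f \<in> L2 \<Omega>"
  unfolding L2_def
  using assms by (auto simp: L2_def norm_vec_squared intro!: borel_measurable_vecI)

lemma L2_inner_integrable:
  assumes "f \<in> L2 \<Omega>" "g \<in> L2 \<Omega>"
  shows "integrable (lebesgue_on \<Omega>) (\<lambda>x. f x \<bullet> g x)"
proof (rule Bochner_Integration.integrable_bound)
  show "integrable (lebesgue_on \<Omega>) (\<lambda>x. (norm (f x))\<^sup>2 + (norm (g x))\<^sup>2)"
    using assms by (intro Bochner_Integration.integrable_add L2_integrable)
  show "(\<lambda>x. f x \<bullet> g x) \<in> borel_measurable (lebesgue_on \<Omega>)"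
    using assms by (intro borel_measurable_inner L2_measurable)
  show "AE x in lebesgue_on \<Omega>. norm (f x \<bullet> g x) \<le> norm ((norm (f x))\<^sup>2 + (norm (g x))\<^sup>2)"
  proof (rule AE_I2)
    fix x
    have "\<bar>f x \<bullet> g x\<bar> \<le> norm (f x) * norm (g x)" by (rule Cauchy_Schwarz_ineq2)
    moreover have "2 * (norm (f x) * norm (g x)) \<le> (norm (f x))\<^sup>2 + (norm (g x))\<^sup>2"
      using sum_squares_bound[of "norm (f x)" "norm (g x)"] by (simp add: mult.assoc)
    moreover have "0 \<le> norm (f x) * norm (g x)" by simp
    ultimately show "norm (f x \<bullet> g x) \<le> norm ((norm (f x))\<^sup>2 + (norm (g x))\<^sup>2)" by simp
  qed
qed

lemma L2_add:
  assumes "f \<in> L2 \<Omega>" "g \<in> L2 \<Omega>"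
  shows "(\<lambda>x. f x + g x) \<in> L2 \<Omega>"
proof -
  have "integrable (lebesgue_on \<Omega>) (\<lambda>x. (norm (f x))\<^sup>2 + 2 * (f x \<bullet> g x) + (norm (g x))\<^sup>2)"
    using assms by (intro Bochner_Integration.integrable_add L2_integrable
        Bochner_Integration.integrable_mult_right L2_inner_integrable) auto
  moreover have "(norm (f x))\<^sup>2 + 2 * (f x \<bullet> g x) + (norm (g x))\<^sup>2 = (norm (f x + g x))\<^sup>2" for x
    by (simp add: power2_norm_eq_inner inner_simps inner_commute)
  ultimately show ?thesis using assms by (auto simp: L2_def)
qed

lemma L2_diff: "f \<in> L2 \<Omega> \<Longrightarrow> g \<in> L2 \<Omega> \<Longrightarrow> (\<lambda>x. f x - g x) \<in> L2 \<Omega>"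
  using L2_add[of f \<Omega> "\<lambda>x. (-1) *\<^sub>R g x"] L2_scaleR[of g \<Omega> "-1"] by simp

lemmas L2_intros = L2_add L2_diff L2_scaleR

lemma L2_inner_add_left:
  "f \<in> L2 \<Omega> \<Longrightarrow> g \<in> L2 \<Omega> \<Longrightarrow> h \<in> L2 \<Omega> \<Longrightarrow>
    L2_inner \<Omega> (\<lambda>x. f x + g x) h = L2_inner \<Omega> f h + L2_inner \<Omega> g h"
  by (simp add: L2_inner_def inner_add_left L2_inner_integrable)

lemma L2_inner_diff_left:
  "f \<in> L2 \<Omega> \<Longrightarrow> g \<in> L2 \<Omega> \<Longrightarrow> h \<in> L2 \<Omega> \<Longrightarrow>
    L2_inner \<Omega> (\<lambda>x. f x - g x) h = L2_inner \<Omega> f h - L2_inner \<Omega> g h"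
  by (simp add: L2_inner_def inner_diff_left L2_inner_integrable)

lemma L2_inner_scaleR_left:
  "L2_inner \<Omega> (\<lambda>x. c *\<^sub>R f x) h = c * L2_inner \<Omega> f h"
  by (simp add: L2_inner_def)

lemma L2_inner_commute: "L2_inner \<Omega> f g = L2_inner \<Omega> g f"
  by (simp add: L2_inner_def inner_commute)

lemma L2_inner_add_right:
  "f \<in> L2 \<Omega> \<Longrightarrow> g \<in> L2 \<Omega> \<Longrightarrow> h \<in> L2 \<Omega> \<Longrightarrow>
    L2_inner \<Omega> h (\<lambda>x. f x + g x) = L2_inner \<Omega> h f + L2_inner \<Omega> h g"
  by (simp add: L2_inner_commute[of \<Omega> h] L2_inner_add_left)

lemma L2_inner_scaleR_right:
  "L2_inner \<Omega> h (\<lambda>x. c *\<^sub>R f x) = c * L2_inner \<Omega> h f"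
  by (simp add: L2_inner_def)

lemma L2_inner_diff_right:
  "f \<in> L2 \<Omega> \<Longrightarrow> g \<in> L2 \<Omega> \<Longrightarrow> h \<in> L2 \<Omega> \<Longrightarrow>
    L2_inner \<Omega> h (\<lambda>x. f x - g x) = L2_inner \<Omega> h f - L2_inner \<Omega> h g"
  by (simp add: L2_inner_commute[of \<Omega> h] L2_inner_diff_left)

lemma L2_inner_vec:
  fixes f g :: "real ^ 'd \<Rightarrow> 'b::euclidean_space ^ 'n"
  assumes "f \<in> L2 \<Omega>" "g \<in> L2 \<Omega>"
  shows "L2_inner \<Omega> f g = (\<Sum>i\<in>UNIV. L2_inner \<Omega> (\<lambda>x. f x $ i) (\<lambda>x. g x $ i))"
  unfolding L2_inner_def inner_vec_def
  by (rule Bochner_Integration.integral_sum) (intro L2_inner_integrable L2_vec_nth assms)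

lemma L2_inner_cong_AE:
  assumes "f \<in> L2 \<Omega>" "g \<in> L2 \<Omega>" "h \<in> L2 \<Omega>" "AE x in lebesgue_on \<Omega>. f x = g x"
  shows "L2_inner \<Omega> f h = L2_inner \<Omega> g h"
  unfolding L2_inner_def using assms
  by (intro integral_cong_AE borel_measurable_integrable L2_inner_integrable) (auto elim: eventually_mono)

lemma L2_inner_zero_AE:
  assumes "AE x in lebesgue_on \<Omega>. f x = 0"
  shows "L2_inner \<Omega> f g = 0"
  unfolding L2_inner_def by (rule integral_eq_zero_AE) (use assms in \<open>auto elim: eventually_mono\<close>)

lemma L2_inner_self_nonneg: "0 \<le> L2_inner \<Omega> f f"
  by (simp add: L2_inner_def)

lemma L2_norm_nonneg: "0 \<le> L2_norm \<Omega> f"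
  by (simp add: L2_norm_def L2_inner_self_nonneg)

lemma L2_norm_squared: "(L2_norm \<Omega> f)\<^sup>2 = L2_inner \<Omega> f f"
  by (simp add: L2_norm_def L2_inner_self_nonneg)

text \<open>Discriminant of the nonnegative quadratic in \<open>q\<close>. Fields are not identified
  up to null sets here, so \<open>?c = 0\<close> does not give \<open>g = 0\<close>; in that case
  \<open>q\<close> is affine in \<open>t\<close>, and a nonzero slope is refuted at the
  \<open>t\<close> where its value is \<open>-1\<close>.\<close>

lemma L2_Cauchy_Schwarz:
  assumes f: "f \<in> L2 \<Omega>" and g: "g \<in> L2 \<Omega>"
  shows "\<bar>L2_inner \<Omega> f g\<bar> \<le> L2_norm \<Omega> f * L2_norm \<Omega> g"
proof -
  let ?a = "L2_inner \<Omega> f f" and ?b = "L2_inner \<Omega> f g" and ?c = "L2_inner \<Omega> g g"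
  have q: "0 \<le> ?a - 2 * t * ?b + t\<^sup>2 * ?c" for t
  proof -
    have "0 \<le> L2_inner \<Omega> (\<lambda>x. f x - t *\<^sub>R g x) (\<lambda>x. f x - t *\<^sub>R g x)"
      by (rule L2_inner_self_nonneg)
    also have "\<dots> = ?a - 2 * t * ?b + t\<^sup>2 * ?c"
      using f g by (simp add: L2_inner_diff_left L2_inner_diff_right L2_intros L2_inner_scaleR_left
          L2_inner_scaleR_right L2_inner_commute[of \<Omega> g f]
          power2_eq_square algebra_simps)
    finally show ?thesis .
  qed
  have "?b\<^sup>2 \<le> ?a * ?c"
  proof (cases "?c = 0")
    case True
    have "?b = 0"
    proof (rule ccontr)
      assume "?b \<noteq> 0"
      with q[of "(?a + 1) / (2 * ?b)"] True show False by simp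
    qed
    with True show ?thesis by simp
  next
    case False
    then have c: "?c > 0" using L2_inner_self_nonneg[of \<Omega> g] by linarith
    have "0 \<le> ?a - ?b\<^sup>2 / ?c"
      using q[of "?b / ?c"] c by (simp add: power2_eq_square field_simps)
    with c show ?thesis by (simp add: field_simps)
  qed
  then have "sqrt (?b\<^sup>2) \<le> sqrt (?a * ?c)" by (rule real_sqrt_le_mono)
  then show ?thesis by (simp add: L2_norm_def real_sqrt_mult)
qed

lemma L2_norm_triangle:
  assumes f: "f \<in> L2 \<Omega>" and g: "g \<in> L2 \<Omega>"
  shows "L2_norm \<Omega> (\<lambda>x. f x + g x) \<le> L2_norm \<Omega> f + L2_norm \<Omega> g"
proof (rule power2_le_imp_le)
  have "(L2_norm \<Omega> (\<lambda>x. f x + g x))\<^sup>2 = L2_inner \<Omega> f f + 2 * L2_inner \<Omega> f g + L2_inner \<Omega> g g"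
    unfolding L2_norm_squared using f g
    by (simp add: L2_inner_add_left L2_inner_add_right L2_add L2_inner_commute[of \<Omega> g f])
  also have "\<dots> \<le> (L2_norm \<Omega> f)\<^sup>2 + 2 * (L2_norm \<Omega> f * L2_norm \<Omega> g) + (L2_norm \<Omega> g)\<^sup>2"
    using L2_Cauchy_Schwarz[OF f g] by (simp add: L2_norm_squared)
  finally show "(L2_norm \<Omega> (\<lambda>x. f x + g x))\<^sup>2 \<le> (L2_norm \<Omega> f + L2_norm \<Omega> g)\<^sup>2"
    by (simp add: power2_eq_square algebra_simps)
qed (simp add: L2_norm_nonneg)

lemma L2_norm_minus_commute: "L2_norm \<Omega> (\<lambda>x. f x - g x) = L2_norm \<Omega> (\<lambda>x. g x - f x)"
  unfolding L2_norm_def L2_inner_def by (simp add: dot_square_norm norm_minus_commute)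

lemma L2_inner_self_eq_zero_AE:
  assumes f: "f \<in> L2 \<Omega>" and z: "L2_inner \<Omega> f f = 0"
  shows "AE x in lebesgue_on \<Omega>. f x = 0"
proof -
  have "AE x in lebesgue_on \<Omega>. f x \<bullet> f x = 0"
    using z L2_inner_integrable[OF f f]
    by (subst integral_nonneg_eq_0_iff_AE[symmetric]) (auto simp: L2_inner_def)
  then show ?thesis by simp
qed

text \<open>Testing with \<open>f - g\<close> itself. This turns a variational identity over all of
  \<open>L2 \<Omega>\<close>, such as the gradient update, into an equation between
  integrands.\<close>

lemma L2_eq_AE:
  assumes f: "f \<in> L2 \<Omega>" and g: "g \<in> L2 \<Omega>"
    and "\<And>h. h \<in> L2 \<Omega> \<Longrightarrow> L2_inner \<Omega> f h = L2_inner \<Omega> g h"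
  shows "AE x in lebesgue_on \<Omega>. f x = g x"
proof -
  have "L2_inner \<Omega> (\<lambda>x. f x - g x) (\<lambda>x. f x - g x) = 0"
    using assms by (simp add: L2_inner_diff_left L2_diff)
  from L2_inner_self_eq_zero_AE[OF L2_diff[OF f g] this] show ?thesis by simp
qed

lemma L2_inner_tendsto_left:
  assumes f: "\<And>k. f k \<in> L2 \<Omega>" and w: "w \<in> L2 \<Omega>" and h: "h \<in> L2 \<Omega>"
    and lim: "((\<lambda>k. L2_norm \<Omega> (\<lambda>x. f k x - w x)) \<longlongrightarrow> 0) F"
  shows "((\<lambda>k. L2_inner \<Omega> (f k) h) \<longlongrightarrow> L2_inner \<Omega> w h) F"
proof (rule LIM_zero_cancel, rule Lim_null_comparison)
  show "\<forall>\<^sub>F k in F. norm (L2_inner \<Omega> (f k) h - L2_inner \<Omega> w h)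
      \<le> L2_norm \<Omega> (\<lambda>x. f k x - w x) * L2_norm \<Omega> h"
  proof (rule always_eventually, rule allI)
    fix k
    show "norm (L2_inner \<Omega> (f k) h - L2_inner \<Omega> w h) \<le> L2_norm \<Omega> (\<lambda>x. f k x - w x) * L2_norm \<Omega> h"
      using L2_Cauchy_Schwarz[OF L2_diff[OF f w] h] by (simp add: L2_inner_diff_left f w h)
  qed
  show "((\<lambda>k. L2_norm \<Omega> (\<lambda>x. f k x - w x) * L2_norm \<Omega> h) \<longlongrightarrow> 0) F"
    using tendsto_mult_left_zero[OF lim] .
qed

section \<open>Green formulas and time regularity\<close>

lemma L2_continuous_on:
  fixes f :: "real ^ 'd \<Rightarrow> 'b::euclidean_space"
  assumes "continuous_on UNIV f" "bounded \<Omega>" "\<Omega> \<in> lmeasurable"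
  shows "f \<in> L2 \<Omega>"
proof -
  have "compact (f ` closure \<Omega>)"
    using assms by (intro compact_continuous_image) (auto intro: continuous_on_subset)
  then have "\<exists>c. \<forall>y\<in>f ` closure \<Omega>. norm y \<le> c"
    using compact_imp_bounded bounded_iff by metis
  then obtain c where c: "\<And>x. x \<in> closure \<Omega> \<Longrightarrow> norm (f x) \<le> c"
    by blast
  show ?thesis
  proof (rule L2_dominated[OF L2_const[OF assms(3), of "1::real"], where c=c])
    show "f \<in> borel_measurable (lebesgue_on \<Omega>)"
      using assms by (intro continuous_imp_measurable_on_sets_lebesgue)
        (auto intro: continuous_on_subset)
    show "AE x in lebesgue_on \<Omega>. norm (f x) \<le> c * norm (1::real)"
      using c closure_subset by (intro AE_I2) (auto simp: space_restrict_space)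
  qed
qed

lemma grad_eqI: "GDERIV f x :> D \<Longrightarrow> grad f x = D"
  unfolding grad_def
proof (rule the_equality)
  fix D' assume "GDERIV f x :> D" "GDERIV f x :> D'"
  then have "(\<lambda>h. h \<bullet> D) = (\<lambda>h. h \<bullet> D')"
    unfolding gderiv_def by (rule has_derivative_unique)
  then have "\<forall>h. h \<bullet> D' = h \<bullet> D" by metis
  then show "D' = D" by (simp only: vector_eq_ldot)
qed

lemma Ck_continuous: "Ck k f \<Longrightarrow> continuous_on UNIV f"
proof (cases k)
  case (Suc j)
  moreover assume "Ck k f"
  ultimately obtain D where "\<And>x. GDERIV f x :> D x" by auto
  then show ?thesis
    unfolding gderiv_def by (meson continuous_at_imp_continuous_on has_derivative_continuous)
qed auto

lemma test_function_L2:
  assumes "f \<in> test_functions \<Omega>" "bounded \<Omega>" "\<Omega> \<in> lmeasurable"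
  shows "f \<in> L2 \<Omega>" and "grad f \<in> L2 \<Omega>"
proof -
  have C: "Ck k f" for k using assms(1) by (simp add: test_functions_def)
  show "f \<in> L2 \<Omega>" using Ck_continuous[OF C] assms(2,3) by (rule L2_continuous_on)
  obtain D where D: "\<And>x. GDERIV f x :> D x" "\<And>i. Ck 0 (\<lambda>x. D x $ i)"
    using C[of "Suc 0"] by auto
  have "grad f = D" using D(1) grad_eqI by blast
  then have "\<And>i. (\<lambda>x. grad f x $ i) \<in> L2 \<Omega>"
    using D(2) assms(2,3) by (intro L2_continuous_on) auto
  then show "grad f \<in> L2 \<Omega>" by (rule L2_vecI)
qed

lemma L2_norm_vec_nth_le:
  fixes f :: "real ^ 'd \<Rightarrow> 'b::euclidean_space ^ 'n"
  assumes "f \<in> L2 \<Omega>"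
  shows "L2_norm \<Omega> (\<lambda>x. f x $ i) \<le> L2_norm \<Omega> f"
  unfolding L2_norm_def L2_inner_def dot_square_norm
  using L2_integrable[OF assms] L2_integrable[OF L2_vec_nth[OF assms, of i]]
  by (intro real_sqrt_le_mono integral_mono power_mono)
    (auto intro: Finite_Cartesian_Product.norm_nth_le)

lemma L2_inner_sum_left:
  assumes "\<And>i. i \<in> I \<Longrightarrow> f i \<in> L2 \<Omega>" "h \<in> L2 \<Omega>"
  shows "L2_inner \<Omega> (\<lambda>x. \<Sum>i\<in>I. f i x) h = (\<Sum>i\<in>I. L2_inner \<Omega> (f i) h)"
  unfolding L2_inner_def inner_sum_left
  by (rule Bochner_Integration.integral_sum) (intro L2_inner_integrable assms)

lemma L2_zero: "(\<lambda>x. 0) \<in> L2 \<Omega>"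
  by (simp add: L2_def)

lemma L2_inner_zero_left [simp]: "L2_inner \<Omega> (\<lambda>x. 0) h = 0"
  by (simp add: L2_inner_def)

text \<open>For test functions this is the definition of the weak divergence; both sides are
  continuous along the approximating sequence contained in \<open>has_grad0\<close>.\<close>

lemma Green_H10_Hdiv:
  assumes \<Omega>: "bounded \<Omega>" "\<Omega> \<in> lmeasurable" and w: "has_grad0 \<Omega> w G" and v: "has_div \<Omega> v r"
  shows "L2_inner \<Omega> w r = - L2_inner \<Omega> G v"
proof -
  obtain f where f: "\<And>k::nat. f k \<in> test_functions \<Omega>"
    and lim: "(\<lambda>k. L2_norm \<Omega> (\<lambda>x. f k x - w x)) \<longlonglongrightarrow> 0"
      "(\<lambda>k. L2_norm \<Omega> (\<lambda>x. grad (f k) x - G x)) \<longlonglongrightarrow> 0"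
    using w unfolding has_grad0_def by blast
  have L: "w \<in> L2 \<Omega>" "G \<in> L2 \<Omega>" "v \<in> L2 \<Omega>" "r \<in> L2 \<Omega>"
    using w v by (auto simp: has_grad0_def has_grad_def has_div_def)
  have "(\<lambda>k. L2_inner \<Omega> (f k) r) \<longlonglongrightarrow> L2_inner \<Omega> w r"
    using test_function_L2(1)[OF f \<Omega>] L lim by (intro L2_inner_tendsto_left)
  moreover have "(\<lambda>k. - L2_inner \<Omega> (grad (f k)) v) \<longlonglongrightarrow> - L2_inner \<Omega> G v"
    using test_function_L2(2)[OF f \<Omega>] L lim by (intro tendsto_minus L2_inner_tendsto_left)
  moreover have "L2_inner \<Omega> (f k) r = - L2_inner \<Omega> (grad (f k)) v" for k
    using v f unfolding has_div_def by (simp add: L2_inner_commute[of \<Omega> _ v] L2_inner_commute[of \<Omega> _ r])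
  ultimately show ?thesis using LIMSEQ_unique by simp
qed

text \<open>The same density argument, with the weak gradient of \<open>v\<close> in place of a weak
  divergence. \<open>v\<close> may have any boundary values, as the vanishing of \<open>w\<close>
  suffices; this is what yields the zero normal trace of the exact velocity.\<close>

lemma Green_H10_H1:
  assumes \<Omega>: "bounded \<Omega>" "\<Omega> \<in> lmeasurable" and w: "has_grad0 \<Omega> w G" and v: "has_grad \<Omega> v H"
  shows "L2_inner \<Omega> w (\<lambda>x. H x $ i) = - L2_inner \<Omega> (\<lambda>x. G x $ i) v"
proof -
  obtain f where f: "\<And>k::nat. f k \<in> test_functions \<Omega>"
    and lim: "(\<lambda>k. L2_norm \<Omega> (\<lambda>x. f k x - w x)) \<longlonglongrightarrow> 0"
      "(\<lambda>k. L2_norm \<Omega> (\<lambda>x. grad (f k) x - G x)) \<longlonglongrightarrow> 0"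
    using w unfolding has_grad0_def by blast
  have L: "w \<in> L2 \<Omega>" "G \<in> L2 \<Omega>" "v \<in> L2 \<Omega>" "H \<in> L2 \<Omega>"
    using w v by (auto simp: has_grad0_def has_grad_def)
  note fL = test_function_L2[OF f \<Omega>]
  have "(\<lambda>k. L2_inner \<Omega> (f k) (\<lambda>x. H x $ i)) \<longlonglongrightarrow> L2_inner \<Omega> w (\<lambda>x. H x $ i)"
    using fL(1) L lim by (intro L2_inner_tendsto_left L2_vec_nth)
  moreover have "(\<lambda>k. - L2_inner \<Omega> (\<lambda>x. grad (f k) x $ i) v) \<longlonglongrightarrow> - L2_inner \<Omega> (\<lambda>x. G x $ i) v"
  proof (intro tendsto_minus L2_inner_tendsto_left L2_vec_nth fL L)
    show "(\<lambda>k. L2_norm \<Omega> (\<lambda>x. grad (f k) x $ i - G x $ i)) \<longlonglongrightarrow> 0"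
    proof (rule tendsto_sandwich[OF _ _ tendsto_const lim(2)])
      show "\<forall>\<^sub>F k in sequentially. L2_norm \<Omega> (\<lambda>x. grad (f k) x $ i - G x $ i)
          \<le> L2_norm \<Omega> (\<lambda>x. grad (f k) x - G x)"
        using L2_norm_vec_nth_le[OF L2_diff[OF fL(2) L(2)], of _ i] by simp
    qed (simp add: L2_norm_nonneg)
  qed
  moreover have "L2_inner \<Omega> (f k) (\<lambda>x. H x $ i) = - L2_inner \<Omega> (\<lambda>x. grad (f k) x $ i) v" for k
    using v f unfolding has_grad_def
    by (simp add: L2_inner_commute[of \<Omega> _ v] L2_inner_commute[of \<Omega> _ "\<lambda>x. H x $ i"])
  ultimately show ?thesis using LIMSEQ_unique by simp
qed

lemma has_vector_grad0_L2:
  assumes "has_vector_grad0 \<Omega> u G"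
  shows "u \<in> L2 \<Omega>" "G \<in> L2 \<Omega>"
  using assms by (auto intro!: L2_vecI[of u] L2_vecI[of G]
      simp: has_vector_grad0_def has_grad0_def has_grad_def)

text \<open>The exact velocity is incompressible through the trace of its gradient, whereas
  orthogonality to pressure gradients is phrased with \<open>has_div0\<close>. Summing the
  componentwise Green formulas over \<open>i\<close> produces exactly this trace, once against test
  functions and once against arbitrary \<open>w\<close> in H1.\<close>

lemma has_div0_trace_zero:
  fixes u :: "real ^ 'd \<Rightarrow> real ^ 'd"
  assumes \<Omega>: "bounded \<Omega>" "\<Omega> \<in> lmeasurable" and u: "has_vector_grad0 \<Omega> u G"
    and tr: "AE x in lebesgue_on \<Omega>. trace (G x) = 0"
  shows "has_div0 \<Omega> u (\<lambda>x. 0)"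
proof -
  note uL = has_vector_grad0_L2[OF u]
  have g: "has_grad0 \<Omega> (\<lambda>x. u x $ i) (\<lambda>x. G x $ i)" for i
    using u by (simp add: has_vector_grad0_def)
  have *: "(\<Sum>i\<in>UNIV. L2_inner \<Omega> (\<lambda>x. G x $ i $ i) w) = 0" if w: "w \<in> L2 \<Omega>" for w
  proof -
    have "(\<Sum>i\<in>UNIV. L2_inner \<Omega> (\<lambda>x. G x $ i $ i) w) = L2_inner \<Omega> (\<lambda>x. trace (G x)) w"
      unfolding trace_def using uL(2) w by (intro L2_inner_sum_left[symmetric] L2_vec_nth)
    then show ?thesis using L2_inner_zero_AE[OF tr] by simp
  qed
  have "L2_inner \<Omega> u (grad f) = 0" if f: "f \<in> test_functions \<Omega>" for f
  proof -
    have "L2_inner \<Omega> u (grad f) = (\<Sum>i\<in>UNIV. L2_inner \<Omega> (\<lambda>x. u x $ i) (\<lambda>x. grad f x $ i))"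
      by (rule L2_inner_vec[OF uL(1) test_function_L2(2)[OF f \<Omega>]])
    also have "\<dots> = (\<Sum>i\<in>UNIV. - L2_inner \<Omega> (\<lambda>x. G x $ i $ i) f)"
      using g f by (intro sum.cong refl) (auto simp: has_grad0_def has_grad_def)
    finally show ?thesis using *[OF test_function_L2(1)[OF f \<Omega>]] by (simp add: sum_negf)
  qed
  moreover have "L2_inner \<Omega> u H = 0" if w: "has_grad \<Omega> w H" for w H
  proof -
    have wL: "w \<in> L2 \<Omega>" "H \<in> L2 \<Omega>" using w by (auto simp: has_grad_def)
    have "L2_inner \<Omega> u H = (\<Sum>i\<in>UNIV. L2_inner \<Omega> (\<lambda>x. u x $ i) (\<lambda>x. H x $ i))"
      by (rule L2_inner_vec[OF uL(1) wL(2)])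
    also have "\<dots> = (\<Sum>i\<in>UNIV. - L2_inner \<Omega> (\<lambda>x. G x $ i $ i) w)"
      using Green_H10_H1[OF \<Omega> g w] by (intro sum.cong refl) auto
    finally show ?thesis using *[OF wL(1)] by (simp add: sum_negf)
  qed
  ultimately show ?thesis
    using uL L2_const[OF \<Omega>(2)] by (auto simp: has_div0_def has_div_def)
qed

lemma has_div_diff:
  assumes \<Omega>: "bounded \<Omega>" "\<Omega> \<in> lmeasurable" and "has_div \<Omega> v g" "has_div \<Omega> w h"
  shows "has_div \<Omega> (\<lambda>x. v x - w x) (\<lambda>x. g x - h x)"
  using assms(3,4) test_function_L2[OF _ \<Omega>]
  by (auto simp: has_div_def L2_inner_diff_left L2_diff)

lemma has_tensor_div_diff:
  assumes \<Omega>: "bounded \<Omega>" "\<Omega> \<in> lmeasurable" and "has_tensor_div \<Omega> \<sigma> r" "has_tensor_div \<Omega> \<tau> s"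
  shows "has_tensor_div \<Omega> (\<lambda>x. \<sigma> x - \<tau> x) (\<lambda>x. r x - s x)"
  using assms(3,4) has_div_diff[OF \<Omega>] by (auto simp: has_tensor_div_def)

lemma has_tensor_div_L2:
  assumes "has_tensor_div \<Omega> \<tau> r"
  shows "\<tau> \<in> L2 \<Omega>" "r \<in> L2 \<Omega>"
  using assms by (auto intro!: L2_vecI[of \<tau>] L2_vecI[of r] simp: has_tensor_div_def has_div_def)

lemma Green_tensor:
  assumes \<Omega>: "bounded \<Omega>" "\<Omega> \<in> lmeasurable"
    and u: "has_vector_grad0 \<Omega> u G" and \<tau>: "has_tensor_div \<Omega> \<tau> r"
  shows "L2_inner \<Omega> u r = - L2_inner \<Omega> G \<tau>"
proof -
  have "L2_inner \<Omega> u r = (\<Sum>i\<in>UNIV. L2_inner \<Omega> (\<lambda>x. u x $ i) (\<lambda>x. r x $ i))"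
    using has_vector_grad0_L2[OF u] has_tensor_div_L2[OF \<tau>] by (intro L2_inner_vec)
  also have "\<dots> = (\<Sum>i\<in>UNIV. - L2_inner \<Omega> (\<lambda>x. G x $ i) (\<lambda>x. \<tau> x $ i))"
    using u \<tau> Green_H10_Hdiv[OF \<Omega>]
    by (intro sum.cong refl) (auto simp: has_vector_grad0_def has_tensor_div_def)
  also have "\<dots> = - L2_inner \<Omega> G \<tau>"
    using has_vector_grad0_L2[OF u] has_tensor_div_L2[OF \<tau>] by (simp add: L2_inner_vec sum_negf)
  finally show ?thesis .
qed

lemma W0_diff:
  assumes "\<Omega> \<in> lmeasurable" "v \<in> W0 \<Omega>" "w \<in> W0 \<Omega>"
  shows "(\<lambda>x. v x - w x) \<in> W0 \<Omega>"
proof -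
  have "integrable (lebesgue_on \<Omega>) z" if "z \<in> W0 \<Omega>" for z
    using L2_inner_integrable[of z \<Omega> "\<lambda>x. 1::real"] L2_const[OF assms(1)] that by (auto simp: W0_def)
  then show ?thesis using assms(2,3) by (auto simp: W0_def L2_diff)
qed

lemma W0_AE_cong:
  assumes "\<Omega> \<in> sets lebesgue" "v \<in> W0 \<Omega>" "AE x in lebesgue_on \<Omega>. v x = w x"
  shows "w \<in> W0 \<Omega>"
proof -
  have w: "w \<in> L2 \<Omega>" using assms L2_AE_cong by (auto simp: W0_def)
  have "(LINT x|lebesgue_on \<Omega>. v x) = (LINT x|lebesgue_on \<Omega>. w x)"
    using assms w by (intro integral_cong_AE) (auto simp: W0_def L2_def)
  then show ?thesis using w assms(2) by (auto simp: W0_def)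
qed

section \<open>Calculus in time for fields with values in L2\<close>

lemma L2_continuous_bounded:
  assumes f: "L2_continuous \<Omega> T f"
  obtains B where "0 \<le> B" "\<And>t. t \<in> {0..T} \<Longrightarrow> L2_norm \<Omega> (f t) \<le> B"
proof -
  have L: "f t \<in> L2 \<Omega>" if "t \<in> {0..T}" for t using f that by (auto simp: L2_continuous_def)
  have "continuous_on {0..T} (\<lambda>t. L2_norm \<Omega> (f t))"
    unfolding continuous_on_def
  proof
    fix t assume t: "t \<in> {0..T}"
    show "((\<lambda>t. L2_norm \<Omega> (f t)) \<longlongrightarrow> L2_norm \<Omega> (f t)) (at t within {0..T})"
    proof (rule LIM_zero_cancel, rule Lim_null_comparison)
      show "((\<lambda>s. L2_norm \<Omega> (\<lambda>x. f s x - f t x)) \<longlongrightarrow> 0) (at t within {0..T})"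
        using f t by (auto simp: L2_continuous_def)
      have "norm (L2_norm \<Omega> (f s) - L2_norm \<Omega> (f t)) \<le> L2_norm \<Omega> (\<lambda>x. f s x - f t x)"
        if s: "s \<in> {0..T}" for s
        using L2_norm_triangle[OF L2_diff[OF L[OF s] L[OF t]] L[OF t]]
          L2_norm_triangle[OF L2_diff[OF L[OF t] L[OF s]] L[OF s]]
          L2_norm_minus_commute[of \<Omega> "f s" "f t"] by simp
      then show "\<forall>\<^sub>F s in at t within {0..T}. norm (L2_norm \<Omega> (f s) - L2_norm \<Omega> (f t))
          \<le> L2_norm \<Omega> (\<lambda>x. f s x - f t x)"
        by (simp add: eventually_at_filter)
    qed
  qed
  then have "bounded ((\<lambda>t. L2_norm \<Omega> (f t)) ` {0..T})"
    by (intro compact_imp_bounded compact_continuous_image) auto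
  then have "\<exists>B. \<forall>t\<in>{0..T}. \<bar>L2_norm \<Omega> (f t)\<bar> \<le> B"
    unfolding bounded_iff by auto
  then obtain B where "\<And>t. t \<in> {0..T} \<Longrightarrow> \<bar>L2_norm \<Omega> (f t)\<bar> \<le> B"
    by blast
  \<comment> \<open>For an empty time interval the bound obtained so far could be negative.\<close>
  then have "L2_norm \<Omega> (f t) \<le> max 0 B" if "t \<in> {0..T}" for t
    using that by (meson abs_le_D1 le_max_iff_disj)
  then show thesis by (intro that[of "max 0 B"]) auto
qed

text \<open>Pairing with a fixed field reduces differentiation in L2 to that of a real function, by
  Cauchy-Schwarz applied to the difference quotient.\<close>

lemma L2_C1_inner_derivative:
  assumes f: "L2_C1 \<Omega> T f f'" and g: "g \<in> L2 \<Omega>" and t: "t \<in> {0..T}"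
  shows "((\<lambda>s. L2_inner \<Omega> (f s) g) has_real_derivative L2_inner \<Omega> (f' t) g) (at t within {0..T})"
proof -
  have L: "f s \<in> L2 \<Omega>" "f' s \<in> L2 \<Omega>" if "s \<in> {0..T}" for s
    using f that by (auto simp: L2_C1_def L2_continuous_def)
  let ?d = "\<lambda>s x. (f s x - f t x) /\<^sub>R (s - t) - f' t x"
  show ?thesis
    unfolding has_field_derivative_iff
  proof (rule LIM_zero_cancel, rule Lim_null_comparison)
    show "((\<lambda>s. L2_norm \<Omega> (?d s) * L2_norm \<Omega> g) \<longlongrightarrow> 0) (at t within {0..T})"
      using f t by (intro tendsto_mult_left_zero) (auto simp: L2_C1_def)
    have "norm ((L2_inner \<Omega> (f s) g - L2_inner \<Omega> (f t) g) / (s - t) - L2_inner \<Omega> (f' t) g)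
        \<le> L2_norm \<Omega> (?d s) * L2_norm \<Omega> g" if s: "s \<in> {0..T}" for s
    proof -
      have "L2_inner \<Omega> (?d s) g = (L2_inner \<Omega> (f s) g - L2_inner \<Omega> (f t) g) / (s - t) - L2_inner \<Omega> (f' t) g"
        using L[OF s] L[OF t] g
        by (simp add: L2_inner_diff_left L2_intros L2_inner_scaleR_left divide_inverse mult.commute)
      moreover have "\<bar>L2_inner \<Omega> (?d s) g\<bar> \<le> L2_norm \<Omega> (?d s) * L2_norm \<Omega> g"
        using L[OF s] L[OF t] g by (intro L2_Cauchy_Schwarz L2_intros)
      ultimately show ?thesis by simp
    qed
    then show "\<forall>\<^sub>F s in at t within {0..T}.
        norm ((L2_inner \<Omega> (f s) g - L2_inner \<Omega> (f t) g) / (s - t) - L2_inner \<Omega> (f' t) g)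
        \<le> L2_norm \<Omega> (?d s) * L2_norm \<Omega> g"
      by (simp add: eventually_at_filter)
  qed
qed

text \<open>Mean value inequality for Hilbert space valued functions: pair with the increment, use
  the real mean value theorem and cancel one factor of the norm. The choice \<open>c = 0\<close>
  gives Lipschitz continuity, and \<open>c = f' b\<close> gives the Taylor remainder.\<close>

lemma L2_C1_increment_bound:
  assumes f: "L2_C1 \<Omega> T f f'" and c: "c \<in> L2 \<Omega>" and ab: "0 \<le> a" "a \<le> b" "b \<le> T"
    and B: "\<And>t. a \<le> t \<Longrightarrow> t \<le> b \<Longrightarrow> L2_norm \<Omega> (\<lambda>x. f' t x - c x) \<le> B"
  shows "L2_norm \<Omega> (\<lambda>x. f b x - f a x - (b - a) *\<^sub>R c x) \<le> (b - a) * B"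
proof -
  have L: "f s \<in> L2 \<Omega>" "f' s \<in> L2 \<Omega>" if "s \<in> {0..T}" for s
    using f that by (auto simp: L2_C1_def L2_continuous_def)
  let ?d = "\<lambda>x. f b x - f a x - (b - a) *\<^sub>R c x"
  have d: "?d \<in> L2 \<Omega>" using ab c by (intro L2_intros L) auto
  \<comment> \<open>The increment of this function over \<open>[a, b]\<close> is the squared norm of
    \<open>?d\<close>.\<close>
  let ?h = "\<lambda>s. L2_inner \<Omega> (f s) ?d - s * L2_inner \<Omega> c ?d"
  have "\<exists>t\<in>{a..b}. ?h b - ?h a = (b - a) * (L2_inner \<Omega> (f' t) ?d - L2_inner \<Omega> c ?d)"
  proof (rule mvt_very_simple[OF ab(2), where f = ?h
        and f' = "\<lambda>t s. s * (L2_inner \<Omega> (f' t) ?d - L2_inner \<Omega> c ?d)"])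
    fix t assume "a \<le> t" "t \<le> b"
    then have t: "t \<in> {a..b}" by simp
    have "((\<lambda>s. L2_inner \<Omega> (f s) ?d) has_real_derivative L2_inner \<Omega> (f' t) ?d) (at t within {a..b})"
      using t ab by (intro DERIV_subset[OF L2_C1_inner_derivative[OF f d]]) auto
    then have "(?h has_real_derivative L2_inner \<Omega> (f' t) ?d - L2_inner \<Omega> c ?d) (at t within {a..b})"
      by (auto intro!: derivative_eq_intros)
    then show "(?h has_derivative (\<lambda>s. s * (L2_inner \<Omega> (f' t) ?d - L2_inner \<Omega> c ?d)))
        (at t within {a..b})"
      by (simp add: has_field_derivative_def mult_commute_abs)
  qed
  then obtain t where t: "t \<in> {a..b}"
    and eq: "?h b - ?h a = (b - a) * (L2_inner \<Omega> (f' t) ?d - L2_inner \<Omega> c ?d)" by blast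
  have ft: "f' t \<in> L2 \<Omega>" using t ab by (intro L) auto
  have "(L2_norm \<Omega> ?d)\<^sup>2 = L2_inner \<Omega> (f b) ?d - L2_inner \<Omega> (f a) ?d - (b - a) * L2_inner \<Omega> c ?d"
    unfolding L2_norm_squared using L[of a] L[of b] ab c d
    by (subst L2_inner_diff_left | simp add: L2_intros L2_inner_scaleR_left)+
  also have "\<dots> = ?h b - ?h a" by (simp add: algebra_simps)
  also have "\<dots> = (b - a) * L2_inner \<Omega> (\<lambda>x. f' t x - c x) ?d"
    unfolding eq using ft c d by (simp only: L2_inner_diff_left)
  also have "\<dots> \<le> (b - a) * (B * L2_norm \<Omega> ?d)"
  proof (intro mult_left_mono)
    have "L2_inner \<Omega> (\<lambda>x. f' t x - c x) ?d \<le> L2_norm \<Omega> (\<lambda>x. f' t x - c x) * L2_norm \<Omega> ?d"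
      using L2_Cauchy_Schwarz[OF L2_diff[OF ft c] d] by linarith
    also have "\<dots> \<le> B * L2_norm \<Omega> ?d"
      using t B by (intro mult_right_mono) (auto simp: L2_norm_nonneg)
    finally show "L2_inner \<Omega> (\<lambda>x. f' t x - c x) ?d \<le> B * L2_norm \<Omega> ?d" .
  qed (use ab in auto)
  finally have le: "L2_norm \<Omega> ?d * L2_norm \<Omega> ?d \<le> ((b - a) * B) * L2_norm \<Omega> ?d"
    by (simp add: power2_eq_square mult.assoc)
  have "0 \<le> B" using B[of a] ab L2_norm_nonneg[of \<Omega> "\<lambda>x. f' a x - c x"] by linarith
  then have nn: "0 \<le> (b - a) * B" using ab by simp
  show ?thesis
  proof (cases "L2_norm \<Omega> ?d = 0")
    case True
    then show ?thesis using nn by simp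
  next
    case False
    then have "0 < L2_norm \<Omega> ?d" using L2_norm_nonneg[of \<Omega> ?d] by linarith
    then show ?thesis using le by (rule mult_right_le_imp_le[rotated])
  qed
qed

lemma L2_C1_increment:
  assumes f: "L2_C1 \<Omega> T f f'"
  obtains B where "0 \<le> B" "\<And>a b. 0 \<le> a \<Longrightarrow> a \<le> b \<Longrightarrow> b \<le> T \<Longrightarrow>
    L2_norm \<Omega> (\<lambda>x. f b x - f a x) \<le> B * (b - a)"
proof -
  obtain B where B: "0 \<le> B" "\<And>t. t \<in> {0..T} \<Longrightarrow> L2_norm \<Omega> (f' t) \<le> B"
    using L2_continuous_bounded f unfolding L2_C1_def by metis
  show thesis
  proof (rule that[OF B(1)])
    fix a b :: real assume ab: "0 \<le> a" "a \<le> b" "b \<le> T"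
    then show "L2_norm \<Omega> (\<lambda>x. f b x - f a x) \<le> B * (b - a)"
      using L2_C1_increment_bound[OF f L2_zero ab, of B] B(2) by (simp add: mult.commute)
  qed
qed

text \<open>The expansion is about the right endpoint because the implicit scheme uses the equation
  at the new time level.\<close>

lemma L2_C2_Taylor:
  assumes f: "L2_C1 \<Omega> T f f'" and f': "L2_C1 \<Omega> T f' f''"
  obtains B where "0 \<le> B" "\<And>a b. 0 \<le> a \<Longrightarrow> a \<le> b \<Longrightarrow> b \<le> T \<Longrightarrow>
    L2_norm \<Omega> (\<lambda>x. f b x - f a x - (b - a) *\<^sub>R f' b x) \<le> B * (b - a)\<^sup>2"
proof -
  obtain B where B: "0 \<le> B" "\<And>a b. 0 \<le> a \<Longrightarrow> a \<le> b \<Longrightarrow> b \<le> T \<Longrightarrow>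
      L2_norm \<Omega> (\<lambda>x. f' b x - f' a x) \<le> B * (b - a)"
    using L2_C1_increment[OF f'] by blast
  show thesis
  proof (rule that[OF B(1)])
    fix a b :: real assume ab: "0 \<le> a" "a \<le> b" "b \<le> T"
    have "f' b \<in> L2 \<Omega>" using f ab by (auto simp: L2_C1_def L2_continuous_def)
    then have "L2_norm \<Omega> (\<lambda>x. f b x - f a x - (b - a) *\<^sub>R f' b x) \<le> (b - a) * (B * (b - a))"
    proof (rule L2_C1_increment_bound[OF f _ ab])
      fix t assume "a \<le> t" "t \<le> b"
      then have "L2_norm \<Omega> (\<lambda>x. f' b x - f' t x) \<le> B * (b - t)" using B(2) ab by auto
      also have "\<dots> \<le> B * (b - a)" using B(1) \<open>a \<le> t\<close> by (intro mult_left_mono) auto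
      finally show "L2_norm \<Omega> (\<lambda>x. f' t x - f' b x) \<le> B * (b - a)"
        by (subst L2_norm_minus_commute)
    qed
    then show "L2_norm \<Omega> (\<lambda>x. f b x - f a x - (b - a) *\<^sub>R f' b x) \<le> B * (b - a)\<^sup>2"
      by (simp add: power2_eq_square mult_ac)
  qed
qed

section \<open>Pointwise estimates and piecewise constant coefficients\<close>

lemma symmetric_inner:
  fixes A :: "real ^ 'n ^ 'n"
  assumes "transpose A = A"
  shows "(A *v x) \<bullet> y = x \<bullet> (A *v y)"
  using dot_lmul_matrix[of x A y] vector_transpose_matrix[of x A] assms by simp

lemma spd_invertible:
  fixes A :: "real ^ 'n ^ 'n"
  assumes "spd A"
  shows "invertible A"
proof -
  have "\<forall>x. A *v x = 0 \<longrightarrow> x = 0"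
    using assms unfolding spd_def by (metis inner_zero_right less_irrefl)
  then show ?thesis
    by (simp add: invertible_left_inverse matrix_left_invertible_ker)
qed

lemma matrix_inv_vector:
  fixes A :: "real ^ 'n ^ 'n"
  assumes "invertible A"
  shows "A *v (matrix_inv A *v x) = x" "matrix_inv A *v (A *v x) = x"
  using matrix_inv_mult[OF assms] by (simp_all add: matrix_vector_mul_assoc)

lemma spd_inv_symmetric:
  fixes A :: "real ^ 'n ^ 'n"
  assumes "spd A"
  shows "(matrix_inv A *v x) \<bullet> y = x \<bullet> (matrix_inv A *v y)"
  using symmetric_inner[of A "matrix_inv A *v x" "matrix_inv A *v y"] assms
  by (simp add: matrix_inv_vector spd_invertible spd_def)

lemma spd_inv_nonneg:
  fixes A :: "real ^ 'n ^ 'n"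
  assumes "spd A"
  shows "0 \<le> x \<bullet> (matrix_inv A *v x)"
proof -
  have "x \<bullet> (matrix_inv A *v x) = (matrix_inv A *v x) \<bullet> (A *v (matrix_inv A *v x))"
    using assms by (simp add: matrix_inv_vector spd_invertible inner_commute)
  then show ?thesis
    using assms unfolding spd_def by (cases "matrix_inv A *v x = 0") (auto simp: less_imp_le)
qed

text \<open>Coercivity at \<open>?y\<close> bounds \<open>a\<close> times the square of
  \<open>norm ?y\<close> by \<open>?y \<bullet> x\<close>. The first bound serves integrability of
  the weighted pressure, the second the source term in the energy.\<close>

lemma spd_coercive_inv:
  fixes A :: "real ^ 'n ^ 'n"
  assumes A: "spd A" and a: "0 < a" "\<And>v. a * (v \<bullet> v) \<le> v \<bullet> (A *v v)"
  shows "norm (matrix_inv A *v x) \<le> norm x / a" "x \<bullet> (matrix_inv A *v x) \<le> (x \<bullet> x) / a"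
proof -
  let ?y = "matrix_inv A *v x"
  have "a * (norm ?y * norm ?y) \<le> ?y \<bullet> x"
    using a(2)[of ?y] A by (simp add: matrix_inv_vector spd_invertible flip: power2_norm_eq_inner power2_eq_square)
  also have "\<dots> \<le> norm ?y * norm x" by (rule norm_cauchy_schwarz)
  finally have "norm ?y * (a * norm ?y) \<le> norm ?y * norm x" by (simp add: mult_ac)
  then have "a * norm ?y \<le> norm x"
    by (cases "norm ?y = 0") (auto simp: mult_le_cancel_left)
  then show n: "norm ?y \<le> norm x / a" using a(1) by (simp add: field_simps)
  have "x \<bullet> ?y \<le> norm x * norm ?y" by (rule norm_cauchy_schwarz)
  also have "\<dots> \<le> norm x * (norm x / a)" using n by (intro mult_left_mono) auto
  finally show "x \<bullet> ?y \<le> (x \<bullet> x) / a"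
    by (simp add: power2_eq_square flip: power2_norm_eq_inner)
qed

text \<open>The converse comparison: an upper bound on \<open>A\<close> is a lower bound on its
  inverse. It is needed to return from the weighted pressure norm to an unweighted one.\<close>

lemma spd_bounded_inv:
  fixes A :: "real ^ 'n ^ 'n"
  assumes A: "spd A" and c: "0 < c" "\<And>v. norm (A *v v) \<le> c * norm v"
  shows "x \<bullet> x \<le> c * (x \<bullet> (matrix_inv A *v x))"
proof -
  let ?y = "matrix_inv A *v x"
  \<comment> \<open>Evaluating the form of \<open>A\<close> at this vector avoids a square root of
    \<open>A\<close>: the terms combine to \<open>x \<bullet> ?y - (x \<bullet> x) / c\<close> once
    \<open>x \<bullet> (A *v x)\<close> is bounded by \<open>c * (x \<bullet> x)\<close>.\<close>
  let ?z = "?y - (1 / c) *\<^sub>R x"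
  have Ay: "A *v ?y = x" using A by (simp add: matrix_inv_vector spd_invertible)
  have "0 \<le> ?z \<bullet> (A *v ?z)"
    using A unfolding spd_def by (cases "?z = 0") (auto simp: less_imp_le)
  also have "\<dots> = x \<bullet> ?y - (2 / c) * (x \<bullet> x) + (1 / c)\<^sup>2 * (x \<bullet> (A *v x))"
    using symmetric_inner[of A x ?y] A
    by (simp add: matrix_vector_mult_diff_distrib matrix_vector_mult_scaleR Ay inner_simps
        inner_commute spd_def power2_eq_square algebra_simps)
  also have "\<dots> \<le> x \<bullet> ?y - (2 / c) * (x \<bullet> x) + (1 / c)\<^sup>2 * (c * (x \<bullet> x))"
  proof -
    have "x \<bullet> (A *v x) \<le> norm x * norm (A *v x)" by (rule norm_cauchy_schwarz)
    also have "\<dots> \<le> norm x * (c * norm x)" using c by (intro mult_left_mono) auto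
    also have "\<dots> = c * (x \<bullet> x)" by (simp add: power2_eq_square flip: power2_norm_eq_inner)
    finally have "(1 / c)\<^sup>2 * (x \<bullet> (A *v x)) \<le> (1 / c)\<^sup>2 * (c * (x \<bullet> x))"
      by (intro mult_left_mono) auto
    then show ?thesis by simp
  qed
  also have "\<dots> = x \<bullet> ?y - (x \<bullet> x) / c"
    using c(1) by (simp add: power2_eq_square field_simps)
  finally show ?thesis using c(1) by (simp add: field_simps)
qed

text \<open>With \<open>a = 1 / \<phi> x\<close> this is the matrix \<open>M\<close> of the
  overview: \<open>h\<close> times the coefficient of the velocity increment in the projection and
  in the gradient update.\<close>

definition shifted :: "real \<Rightarrow> real \<Rightarrow> real ^ 'n ^ 'n \<Rightarrow> real ^ 'n ^ 'n" where
  "shifted a h L = a *\<^sub>R mat 1 + h *\<^sub>R L"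

lemma shifted_vector: "shifted a h L *v v = a *\<^sub>R v + h *\<^sub>R (L *v v)"
  by (simp add: shifted_def matrix_vector_mult_add_rdistrib scaleR_matrix_vector_assoc[symmetric])

lemma shifted_spd:
  fixes L :: "real ^ 'n ^ 'n"
  assumes "0 < a" "0 \<le> h" "transpose L = L" "\<And>v. 0 \<le> v \<bullet> (L *v v)"
  shows "spd (shifted a h L)"
    and "a * (v \<bullet> v) \<le> v \<bullet> (shifted a h L *v v)"
proof -
  have "transpose (shifted a h L) = shifted a h L"
    using assms(3) by (auto simp: shifted_def transpose_def mat_def vec_eq_iff)
  moreover have c: "a * (v \<bullet> v) \<le> v \<bullet> (shifted a h L *v v)" for v
    using assms by (simp add: shifted_vector inner_simps)
  moreover have "0 < a * (v \<bullet> v)" if "v \<noteq> 0" for v :: "real ^ 'n"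
    using assms(1) that by simp
  ultimately show "spd (shifted a h L)"
    unfolding spd_def by (meson less_le_trans)
  show "a * (v \<bullet> v) \<le> v \<bullet> (shifted a h L *v v)" by (rule c)
qed

text \<open>Here \<open>A\<close> plays the role of \<open>M\<close>. Both sides of the update are
  squared in the form of the inverse matrix. The term \<open>e' \<bullet> p'\<close> is kept, since
  it vanishes only after integration.\<close>

lemma pressure_velocity_step:
  fixes A :: "real ^ 'n ^ 'n"
  assumes A: "spd A" and h: "0 < h"
    and eq: "A *v (e' - et) + h *\<^sub>R (p' - p) = h *\<^sub>R d"
  shows "e' \<bullet> (A *v e') + 2 * h * (e' \<bullet> p') + h\<^sup>2 * (p' \<bullet> (matrix_inv A *v p'))
    \<le> et \<bullet> (A *v et) + 2 * h * (et \<bullet> p) + (1 + h) * (h\<^sup>2 * (p \<bullet> (matrix_inv A *v p)))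
      + 2 * h * (d \<bullet> et) + (h + h\<^sup>2) * (d \<bullet> (matrix_inv A *v d))"
proof -
  let ?N = "\<lambda>v. matrix_inv A *v v"
  have i: "invertible A" using A by (rule spd_invertible)
  have lin: "?N (v + w) = ?N v + ?N w" "?N (v - w) = ?N v - ?N w" "?N (c *\<^sub>R v) = c *\<^sub>R ?N v" for v w c
    by (simp_all add: matrix_vector_right_distrib matrix_vector_mult_diff_distrib matrix_vector_mult_scaleR)
  have sym: "v \<bullet> ?N w = w \<bullet> ?N v" for v w
    using spd_inv_symmetric[OF A, of v w] by (simp add: inner_commute)
  have can: "(A *v y) \<bullet> ?N v = y \<bullet> v" for y v
    using sym[of "A *v y" v] by (simp add: matrix_inv_vector i inner_commute)
  define w where "w = A *v et + h *\<^sub>R p"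
  have w': "A *v e' + h *\<^sub>R p' = w + h *\<^sub>R d"
    using eq by (simp add: w_def matrix_vector_mult_diff_distrib algebra_simps)
  have q: "(A *v y + h *\<^sub>R v) \<bullet> ?N (A *v y + h *\<^sub>R v)
      = y \<bullet> (A *v y) + 2 * h * (y \<bullet> v) + h\<^sup>2 * (v \<bullet> ?N v)" for y v
    by (simp add: lin matrix_inv_vector i inner_simps can inner_commute power2_eq_square algebra_simps)
  have Nw: "?N w = et + h *\<^sub>R ?N p" by (simp add: w_def lin matrix_inv_vector i)
  have "(w + h *\<^sub>R d) \<bullet> ?N (w + h *\<^sub>R d)
      = w \<bullet> ?N w + 2 * h * (d \<bullet> ?N w) + h\<^sup>2 * (d \<bullet> ?N d)"
    using sym[of w d] by (simp add: lin inner_simps power2_eq_square algebra_simps)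
  also have "\<dots> = w \<bullet> ?N w + 2 * h * (d \<bullet> et) + h * (2 * h * (d \<bullet> ?N p)) + h\<^sup>2 * (d \<bullet> ?N d)"
    by (simp add: Nw inner_simps power2_eq_square algebra_simps)
  \<comment> \<open>Weighted Young inequality with one factor \<open>h\<close> kept in front: the
    old pressure term then only gains the factor \<open>1 + h\<close>, and the increment
    \<open>d\<close>, itself of order \<open>h\<close>, contributes at order \<open>h\<close>
    cubed.\<close>
  also have "\<dots> \<le> w \<bullet> ?N w + 2 * h * (d \<bullet> et) + h * (h\<^sup>2 * (p \<bullet> ?N p) + d \<bullet> ?N d) + h\<^sup>2 * (d \<bullet> ?N d)"
  proof -
    have "0 \<le> (h *\<^sub>R p - d) \<bullet> ?N (h *\<^sub>R p - d)" by (rule spd_inv_nonneg[OF A])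
    also have "\<dots> = h\<^sup>2 * (p \<bullet> ?N p) - 2 * h * (d \<bullet> ?N p) + d \<bullet> ?N d"
      using sym[of p d] by (simp add: lin inner_simps power2_eq_square algebra_simps)
    finally have "h * (2 * h * (d \<bullet> ?N p)) \<le> h * (h\<^sup>2 * (p \<bullet> ?N p) + d \<bullet> ?N d)"
      using h by (intro mult_left_mono) auto
    then show ?thesis by simp
  qed
  finally show ?thesis
    using q[of e' p'] q[of et p] by (simp add: w' w_def[symmetric] algebra_simps)
qed

text \<open>The term with \<open>et - e\<close> and the bracket multiplied by \<open>2 * h\<close>
  are not simplified further: together they form the predictor error equation tested with
  \<open>2 * h\<close> times \<open>et\<close>, which is available only in integrated form.\<close>

lemma energy_step_pointwise:
  fixes L :: "real ^ 'n ^ 'n"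
  assumes a: "0 < a" and h: "0 < h"
    and L: "transpose L = L" "\<And>v. 0 \<le> v \<bullet> (L *v v)"
    and eq: "a *\<^sub>R ((e' - et) /\<^sub>R h) + L *v (e' - et) + (p' - p) = d"
  defines "N \<equiv> matrix_inv (shifted a h L)"
  shows "a * (e' \<bullet> e') + h * (e' \<bullet> (L *v e')) + h * (et \<bullet> (L *v et))
      + h\<^sup>2 * (p' \<bullet> (N *v p')) + 2 * h * (e' \<bullet> p')
    \<le> 2 * (a * ((et - e) \<bullet> et)) + 2 * h * (p \<bullet> et + et \<bullet> (L *v et) - (a * (R \<bullet> et) - d \<bullet> et))
      + (1 + h) * (a * (e \<bullet> e) + h\<^sup>2 * (p \<bullet> (N *v p)))
      + (h + h\<^sup>2) * (a * (R \<bullet> R) + (d \<bullet> d) / a)"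
proof -
  let ?A = "shifted a h L"
  have A: "spd ?A" and c: "\<And>v. a * (v \<bullet> v) \<le> v \<bullet> (?A *v v)"
    using shifted_spd[of a h L] a h L by auto
  have "?A *v (e' - et) + h *\<^sub>R (p' - p) = h *\<^sub>R d"
    unfolding eq[symmetric] using h by (simp add: shifted_vector scaleR_add_right)
  from pressure_velocity_step[OF A h this]
  have 1: "e' \<bullet> (?A *v e') + 2 * h * (e' \<bullet> p') + h\<^sup>2 * (p' \<bullet> (N *v p'))
    \<le> et \<bullet> (?A *v et) + 2 * h * (et \<bullet> p) + (1 + h) * (h\<^sup>2 * (p \<bullet> (N *v p)))
      + 2 * h * (d \<bullet> et) + (h + h\<^sup>2) * (d \<bullet> (N *v d))"
    by (simp add: N_def)
  have 2: "(h + h\<^sup>2) * (d \<bullet> (N *v d)) \<le> (h + h\<^sup>2) * ((d \<bullet> d) / a)"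
    using spd_coercive_inv(2)[OF A a c] h by (intro mult_left_mono) (auto simp: N_def)
  \<comment> \<open>Both squares in the proof together give the split
    \<open>et = (et - e) + e\<close>. The square of \<open>et - e\<close> is available because
    \<open>2 (et - e) \<bullet> et\<close> equals the square of \<open>et\<close> minus that of
    \<open>e\<close> plus that of \<open>et - e\<close>.\<close>
  have 3: "2 * h * (a * (R \<bullet> et)) \<le> a * ((et - e) \<bullet> (et - e)) + h * (a * (e \<bullet> e)) + (h + h\<^sup>2) * (a * (R \<bullet> R))"
  proof -
    have "0 \<le> a * ((et - e - h *\<^sub>R R) \<bullet> (et - e - h *\<^sub>R R)) + h * (a * ((e - R) \<bullet> (e - R)))"
      using a h by simp
    then show ?thesis
      by (simp add: inner_simps inner_commute power2_eq_square algebra_simps)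
  qed
  show ?thesis
    using 1 2 3 by (simp add: shifted_vector inner_simps inner_commute power2_eq_square algebra_simps)
qed

text \<open>The accumulated dissipation is nonnegative, so multiplying it by \<open>1 + h\<close> as
  well is harmless and \<open>F n + ?S\<close> obeys the recursion of \<open>F\<close>. Then
  \<open>1 + h \<le> exp h\<close> closes the induction.\<close>

lemma discrete_Gronwall:
  fixes F D :: "nat \<Rightarrow> real"
  assumes step: "\<And>n. n < N \<Longrightarrow> F (Suc n) + D n \<le> (1 + h) * F n + K"
    and D: "\<And>n. n < N \<Longrightarrow> 0 \<le> D n" and "F 0 = 0" "0 \<le> h" "0 \<le> K"
  shows "n \<le> N \<Longrightarrow> F n + (\<Sum>k<n. D k) \<le> real n * K * exp (real n * h)"
proof (induction n)
  case (Suc n)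
  let ?S = "\<Sum>k<n. D k"
  have S: "0 \<le> ?S" using D Suc.prems by (intro sum_nonneg) auto
  have IH: "F n + ?S \<le> real n * K * exp (real n * h)" using Suc by auto
  have "F (Suc n) + (\<Sum>k<Suc n. D k) \<le> (1 + h) * F n + K + ?S"
    using step[of n] Suc.prems by simp
  also have "\<dots> \<le> (1 + h) * (F n + ?S) + K"
    using S \<open>0 \<le> h\<close> by (simp add: algebra_simps)
  also have "\<dots> \<le> (1 + h) * (real n * K * exp (real n * h)) + K"
    using IH \<open>0 \<le> h\<close> by (intro add_right_mono mult_left_mono) auto
  also have "\<dots> \<le> exp h * (real n * K * exp (real n * h)) + K * exp (real (Suc n) * h)"
    using \<open>0 \<le> h\<close> \<open>0 \<le> K\<close> mult_left_mono[of 1 "exp (real (Suc n) * h)" K]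
    by (intro add_mono mult_right_mono) auto
  also have "\<dots> = real (Suc n) * K * exp (real (Suc n) * h)"
    by (simp add: algebra_simps exp_add)
  finally show ?case .
qed (use assms in simp)

section \<open>Measurability and bounds of the coefficients\<close>

lemma piecewise_constant_AE:
  fixes \<phi> :: "real ^ 'd \<Rightarrow> real"
  assumes M: "simplicial_partition M \<Omega>" and \<phi>: "piecewise_constant M \<Omega> \<phi>"
    and \<Omega>: "\<Omega> \<in> sets lebesgue"
  obtains k where "\<And>S x. S \<in> M \<Longrightarrow> x \<in> interior S \<Longrightarrow> x \<in> \<Omega> \<Longrightarrow> \<phi> x = k S"
    and "AE x in lebesgue_on \<Omega>. x \<in> \<Omega> \<and> (\<exists>S\<in>M. x \<in> interior S)"
proof -
  have "\<forall>S\<in>M. \<exists>y. \<forall>x\<in>interior S \<inter> \<Omega>. \<phi> x = y"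
    using \<phi> by (simp add: piecewise_constant_def constant_on_def)
  then obtain k where k: "\<forall>S\<in>M. \<forall>x\<in>interior S \<inter> \<Omega>. \<phi> x = k S" by metis
  \<comment> \<open>Piecewise constancy does not restrict \<phi> on the faces. Simplices are convex,
    so finitely many of their frontiers form a null set.\<close>
  have "negligible (\<Union>S\<in>M. frontier S)"
    using M by (intro negligible_Union)
      (auto simp: simplicial_partition_def intro!: negligible_convex_frontier convex_simplex)
  then have "AE x in lebesgue. x \<notin> (\<Union>S\<in>M. frontier S)"
    unfolding negligible_iff_null_sets by (rule AE_not_in)
  then have "AE x in lebesgue_on \<Omega>. x \<in> \<Omega> \<and> x \<notin> (\<Union>S\<in>M. frontier S)"
    using \<Omega> by (auto simp: AE_restrict_space_iff elim: eventually_mono)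
  then have "AE x in lebesgue_on \<Omega>. x \<in> \<Omega> \<and> (\<exists>S\<in>M. x \<in> interior S)"
  proof eventually_elim
    case (elim x)
    then have "x \<in> \<Union>M"
      using M closure_subset[of \<Omega>] by (auto simp: simplicial_partition_def)
    then obtain S where "S \<in> M" "x \<in> S" by blast
    with elim show ?case
      using closure_subset[of S] by (auto simp: frontier_def)
  qed
  with k that show thesis by blast
qed

text \<open>Off the faces \<phi> agrees with a finite combination of indicators, of which
  disjointness of the interiors leaves one nonzero summand.\<close>

lemma piecewise_constant_measurable:
  fixes \<phi> :: "real ^ 'd \<Rightarrow> real"
  assumes M: "simplicial_partition M \<Omega>" and \<phi>: "piecewise_constant M \<Omega> \<phi>"
    and \<Omega>: "\<Omega> \<in> sets lebesgue"
  shows "\<phi> \<in> borel_measurable (lebesgue_on \<Omega>)"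
proof -
  obtain k where k: "\<And>S x. S \<in> M \<Longrightarrow> x \<in> interior S \<Longrightarrow> x \<in> \<Omega> \<Longrightarrow> \<phi> x = k S"
    and ae: "AE x in lebesgue_on \<Omega>. x \<in> \<Omega> \<and> (\<exists>S\<in>M. x \<in> interior S)"
    using piecewise_constant_AE[OF M \<phi> \<Omega>] by blast
  have fin: "finite M" using M by (simp add: simplicial_partition_def)
  show ?thesis
  proof (rule borel_measurable_lebesgue_on_AE[OF \<Omega>])
    show "(\<lambda>x. \<Sum>S\<in>M. k S * indicator (interior S) x) \<in> borel_measurable (lebesgue_on \<Omega>)"
      by (intro borel_measurable_sum borel_measurable_times borel_measurable_const
          measurable_restrict_space1 borel_measurable_indicator) auto
    show "AE x in lebesgue_on \<Omega>. (\<Sum>S\<in>M. k S * indicator (interior S) x) = \<phi> x"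
      using ae
    proof eventually_elim
      case (elim x)
      then obtain S where S: "S \<in> M" "x \<in> interior S" "x \<in> \<Omega>" by blast
      have "k S' * indicator (interior S') x = 0" if "S' \<in> M - {S}" for S'
      proof -
        have "interior S \<inter> interior S' = {}"
          using M S(1) that by (auto simp: simplicial_partition_def dest: pairwiseD)
        then show ?thesis using S(2) by (auto simp: indicator_def)
      qed
      then have "(\<Sum>S\<in>M - {S}. k S * indicator (interior S) x) = 0"
        by (intro sum.neutral) auto
      then have "(\<Sum>S\<in>M. k S * indicator (interior S) x) = k S * indicator (interior S) x"
        unfolding sum.remove[OF fin S(1)] by linarith
      then show ?case using S k by simp
    qed
  qed
qed

lemma piecewise_constant_bounds:
  fixes \<phi> :: "real ^ 'd \<Rightarrow> real"
  assumes M: "simplicial_partition M \<Omega>" and \<phi>: "piecewise_constant M \<Omega> \<phi>"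
    and \<Omega>: "\<Omega> \<in> sets lebesgue" and pos: "\<forall>x\<in>\<Omega>. 0 < \<phi> x"
  obtains c where "0 < c" "AE x in lebesgue_on \<Omega>. 0 < \<phi> x \<and> \<phi> x \<le> c \<and> 1 / \<phi> x \<le> c"
proof -
  obtain k where k: "\<And>S x. S \<in> M \<Longrightarrow> x \<in> interior S \<Longrightarrow> x \<in> \<Omega> \<Longrightarrow> \<phi> x = k S"
    and ae: "AE x in lebesgue_on \<Omega>. x \<in> \<Omega> \<and> (\<exists>S\<in>M. x \<in> interior S)"
    using piecewise_constant_AE[OF M \<phi> \<Omega>] by blast
  have fin: "finite M" using M by (simp add: simplicial_partition_def)
  \<comment> \<open>The value \<open>k S\<close> is arbitrary when the interior of \<open>S\<close>
    misses \<Omega>, hence the absolute values; the leading \<open>1\<close> makes the bound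
    positive in every case.\<close>
  let ?c = "1 + (\<Sum>S\<in>M. \<bar>k S\<bar> + \<bar>1 / k S\<bar>)"
  have "0 < ?c" by (intro add_pos_nonneg sum_nonneg) auto
  moreover have "AE x in lebesgue_on \<Omega>. 0 < \<phi> x \<and> \<phi> x \<le> ?c \<and> 1 / \<phi> x \<le> ?c"
    using ae
  proof eventually_elim
    case (elim x)
    then obtain S where S: "S \<in> M" "x \<in> interior S" "x \<in> \<Omega>" by blast
    have "\<bar>k S\<bar> + \<bar>1 / k S\<bar> \<le> (\<Sum>S\<in>M. \<bar>k S\<bar> + \<bar>1 / k S\<bar>)"
      using fin S by (intro member_le_sum) auto
    moreover have "0 < \<phi> x" "\<phi> x = k S" using S pos k by auto
    moreover have "k S \<le> \<bar>k S\<bar>" "1 / k S \<le> \<bar>1 / k S\<bar>" by (rule abs_ge_self)+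
    moreover have "0 \<le> \<bar>k S\<bar>" "0 \<le> \<bar>1 / k S\<bar>" by (rule abs_ge_zero)+
    ultimately have "0 < \<phi> x" "k S \<le> ?c" "1 / k S \<le> ?c" "\<phi> x = k S" by linarith+
    then show ?case by simp
  qed
  ultimately show thesis by (rule that)
qed

lemma bounded_matrix_image:
  fixes L :: "'a \<Rightarrow> real ^ 'n ^ 'm"
  assumes "bounded (L ` S)"
  obtains c where "0 < c" "\<And>x v. x \<in> S \<Longrightarrow> norm (L x *v v) \<le> c * norm v"
proof -
  obtain B where B: "0 < B" "\<And>x. x \<in> S \<Longrightarrow> norm (L x) \<le> B"
    using assms by (auto simp: bounded_pos)
  let ?c = "real CARD('m) * real CARD('n) * B"
  have "norm (L x *v v) \<le> ?c * norm v" if "x \<in> S" for x v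
  proof -
    have "\<bar>L x $ i $ j\<bar> \<le> B" for i j
      using B(2)[OF that] Finite_Cartesian_Product.norm_nth_le[of "L x" i]
        component_le_norm_cart[of "L x $ i" j] by linarith
    then have "onorm ((*v) (L x)) \<le> ?c" by (rule onorm_le_matrix_component)
    moreover have "norm (L x *v v) \<le> onorm ((*v) (L x)) * norm v"
      by (intro onorm matrix_vector_mul_bounded_linear)
    ultimately show ?thesis
      by (meson mult_right_mono norm_ge_zero order_trans)
  qed
  moreover have "0 < ?c" using B(1) by simp
  ultimately show thesis using that by blast
qed

section \<open>Energy estimate for one time step\<close>

text \<open>A single \<open>c\<close> bounds \<phi>, its reciprocal and the drag. The bounds on
  \<phi> hold only almost everywhere, because on the faces of the partition just its positivity is
  known.\<close>

locale brinkman_coefficients =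
  fixes \<Omega> :: "(real ^ 'd) set" and \<phi> :: "real ^ 'd \<Rightarrow> real"
    and L :: "real ^ 'd \<Rightarrow> real ^ 'd ^ 'd" and c :: real
  assumes bounded_domain: "bounded \<Omega>" and lmeasurable_domain: "\<Omega> \<in> lmeasurable"
    and c_pos: "0 < c"
    and \<phi>_measurable: "\<phi> \<in> borel_measurable (lebesgue_on \<Omega>)"
    and \<phi>_pos: "\<And>x. x \<in> \<Omega> \<Longrightarrow> 0 < \<phi> x"
    and \<phi>_bounds: "AE x in lebesgue_on \<Omega>. \<phi> x \<le> c \<and> 1 / \<phi> x \<le> c"
    and L_measurable: "L \<in> borel_measurable (lebesgue_on \<Omega>)"
    and L_symmetric: "\<And>x. x \<in> \<Omega> \<Longrightarrow> transpose (L x) = L x"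
    and L_nonneg: "\<And>x v. x \<in> \<Omega> \<Longrightarrow> 0 \<le> v \<bullet> (L x *v v)"
    and L_bounded: "\<And>x v. x \<in> \<Omega> \<Longrightarrow> norm (L x *v v) \<le> c * norm v"
begin

lemma sets_domain: "\<Omega> \<in> sets lebesgue"
  using lmeasurable_domain by (rule fmeasurableD)

lemma space_domain [simp]: "space (lebesgue_on \<Omega>) = \<Omega>"
  by (simp add: space_restrict_space)

lemma AE_domain: "AE x in lebesgue_on \<Omega>. x \<in> \<Omega>"
  by (rule AE_I2) simp

definition shift_inv :: "real \<Rightarrow> real ^ 'd \<Rightarrow> real ^ 'd ^ 'd" where
  "shift_inv h x = matrix_inv (shifted (1 / \<phi> x) h (L x))"

lemma \<phi>_L2: "f \<in> L2 \<Omega> \<Longrightarrow> (\<lambda>x. \<phi> x *\<^sub>R f x) \<in> L2 \<Omega>"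
  using \<phi>_bounds AE_domain
  by (intro L2_mult_bounded[where c=c] \<phi>_measurable)
    (auto elim!: eventually_elim2 simp: abs_of_pos \<phi>_pos)

lemma inverse_\<phi>_L2: "f \<in> L2 \<Omega> \<Longrightarrow> (\<lambda>x. (1 / \<phi> x) *\<^sub>R f x) \<in> L2 \<Omega>"
  using \<phi>_bounds AE_domain
  by (intro L2_mult_bounded[where c=c] borel_measurable_divide \<phi>_measurable borel_measurable_const)
    (auto elim!: eventually_elim2 simp: abs_of_pos \<phi>_pos)

lemma L_L2: "f \<in> L2 \<Omega> \<Longrightarrow> (\<lambda>x. L x *v f x) \<in> L2 \<Omega>"
  by (rule L2_matrix_bounded[where c=c]) (auto intro!: L_measurable AE_I2 L_bounded)

lemma shifted_facts:
  assumes "0 < h" "x \<in> \<Omega>"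
  shows "spd (shifted (1 / \<phi> x) h (L x))"
    and "1 / \<phi> x * (v \<bullet> v) \<le> v \<bullet> (shifted (1 / \<phi> x) h (L x) *v v)"
  using shifted_spd[of "1 / \<phi> x" h "L x"] assms \<phi>_pos L_symmetric L_nonneg by auto

text \<open>Coercivity with constant \<open>1 / \<phi> x\<close> bounds the inverse by
  \<open>\<phi> x \<le> c\<close>, uniformly in \<open>h\<close>.\<close>

lemma shift_inv_L2:
  assumes h: "0 < h" and f: "f \<in> L2 \<Omega>"
  shows "(\<lambda>x. shift_inv h x *v f x) \<in> L2 \<Omega>"
proof (rule L2_matrix_bounded[OF f, where c=c])
  have "(\<lambda>x. shifted (1 / \<phi> x) h (L x)) \<in> borel_measurable (lebesgue_on \<Omega>)"
    unfolding shifted_def using \<phi>_measurable L_measurable by measurable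
  then show "shift_inv h \<in> borel_measurable (lebesgue_on \<Omega>)"
    unfolding shift_inv_def using h
    by (intro borel_measurable_matrix_inv) (auto intro: spd_invertible shifted_facts)
  show "AE x in lebesgue_on \<Omega>. \<forall>v. norm (shift_inv h x *v v) \<le> c * norm v"
    using \<phi>_bounds AE_domain
  proof eventually_elim
    case (elim x)
    have "norm (shift_inv h x *v v) \<le> \<phi> x * norm v" for v
      using spd_coercive_inv(1)[OF shifted_facts(1)[OF h elim(2)] _ shifted_facts(2)[OF h elim(2)]]
        \<phi>_pos[OF elim(2)] by (auto simp: shift_inv_def mult.commute)
    then show ?case using elim by (meson mult_right_mono norm_ge_zero order_trans)
  qed
qed

text \<open>The pressure carries the weight in which the update is squared; the weight \<phi> of the
  final estimate is recovered by \<open>pressure_weight_bound\<close>.\<close>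

definition energy :: "real \<Rightarrow> (real ^ 'd \<Rightarrow> real ^ 'd) \<Rightarrow> (real ^ 'd \<Rightarrow> real ^ 'd) \<Rightarrow> real" where
  "energy h e p = L2_inner \<Omega> (\<lambda>x. (1 / \<phi> x) *\<^sub>R e x) e
    + h\<^sup>2 * L2_inner \<Omega> (\<lambda>x. shift_inv h x *v p x) p"

lemma weighted_le:
  assumes f: "f \<in> L2 \<Omega>" and w: "(\<lambda>x. w x *\<^sub>R f x) \<in> L2 \<Omega>" "AE x in lebesgue_on \<Omega>. w x \<le> c"
  shows "L2_inner \<Omega> (\<lambda>x. w x *\<^sub>R f x) f \<le> c * (L2_norm \<Omega> f)\<^sup>2"
proof -
  have "L2_inner \<Omega> (\<lambda>x. w x *\<^sub>R f x) f \<le> (LINT x|lebesgue_on \<Omega>. c * (f x \<bullet> f x))"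
    unfolding L2_inner_def
    using w(2) by (intro integral_mono_AE L2_inner_integrable f w(1) Bochner_Integration.integrable_mult_right)
      (auto elim!: eventually_mono intro!: mult_right_mono)
  then show ?thesis by (simp add: L2_norm_squared L2_inner_def)
qed

text \<open>The shifted matrix has norm at most \<open>c + h * c\<close>, so its inverse dominates
  the reciprocal of this number; the remaining \<open>c\<close> bounds \<phi>. For
  \<open>h \<le> T\<close> the factor is bounded independently of the step.\<close>

lemma pressure_weight_bound:
  assumes h: "0 < h" and p: "p \<in> L2 \<Omega>"
  shows "L2_inner \<Omega> (\<lambda>x. \<phi> x *\<^sub>R p x) p \<le> c * (c + h * c) * L2_inner \<Omega> (\<lambda>x. shift_inv h x *v p x) p"
proof -
  have "L2_inner \<Omega> (\<lambda>x. \<phi> x *\<^sub>R p x) p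
      \<le> (LINT x|lebesgue_on \<Omega>. c * (c + h * c) * ((shift_inv h x *v p x) \<bullet> p x))"
    unfolding L2_inner_def
  proof (intro integral_mono_AE L2_inner_integrable p \<phi>_L2 shift_inv_L2 h
      Bochner_Integration.integrable_mult_right)
    show "AE x in lebesgue_on \<Omega>. \<phi> x *\<^sub>R p x \<bullet> p x \<le> c * (c + h * c) * ((shift_inv h x *v p x) \<bullet> p x)"
      using \<phi>_bounds AE_domain
    proof eventually_elim
      case (elim x)
      let ?A = "shifted (1 / \<phi> x) h (L x)"
      have "norm (?A *v v) \<le> (c + h * c) * norm v" for v
      proof -
        have "norm (?A *v v) \<le> \<bar>1 / \<phi> x\<bar> * norm v + \<bar>h\<bar> * norm (L x *v v)"
          unfolding shifted_vector by (rule norm_triangle_le) simp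
        also have "\<dots> \<le> c * norm v + h * (c * norm v)"
          using elim h \<phi>_pos[of x] L_bounded[of x v]
          by (intro add_mono mult_right_mono mult_mono) auto
        finally show ?thesis by (simp add: algebra_simps)
      qed
      moreover have "0 < c + h * c" using c_pos h by (simp add: add_pos_pos)
      ultimately have *: "p x \<bullet> p x \<le> (c + h * c) * (p x \<bullet> (matrix_inv ?A *v p x))"
        using spd_bounded_inv[OF shifted_facts(1)[OF h elim(2)]] by blast
      have "\<phi> x * (p x \<bullet> p x) \<le> c * (p x \<bullet> p x)"
        using elim by (intro mult_right_mono) auto
      also have "\<dots> \<le> c * ((c + h * c) * (p x \<bullet> (matrix_inv ?A *v p x)))"
        using * c_pos by (intro mult_left_mono) auto
      finally show ?case by (simp add: shift_inv_def inner_commute mult.assoc)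
    qed
  qed
  then show ?thesis by (simp add: L2_inner_def)
qed

text \<open>Integrates the pointwise inequality, supplying the two facts that hold only globally.
  \<open>D\<close> stands for the stress error, which reaches the left side with the factor
  \<open>2 * h\<close>.\<close>

lemma energy_step:
  assumes h: "0 < h"
    and L2: "e \<in> L2 \<Omega>" "et \<in> L2 \<Omega>" "e' \<in> L2 \<Omega>" "p \<in> L2 \<Omega>" "p' \<in> L2 \<Omega>" "d \<in> L2 \<Omega>" "R \<in> L2 \<Omega>"
    and update: "AE x in lebesgue_on \<Omega>.
      (1 / \<phi> x) *\<^sub>R ((e' x - et x) /\<^sub>R h) + L x *v (e' x - et x) + (p' x - p x) = d x"
    and orthogonal: "L2_inner \<Omega> e' p' = 0"
    and predictor: "D + L2_inner \<Omega> (\<lambda>x. (1 / \<phi> x) *\<^sub>R ((et x - e x) /\<^sub>R h)) et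
      + L2_inner \<Omega> p et + L2_inner \<Omega> (\<lambda>x. L x *v et x) et
      = L2_inner \<Omega> (\<lambda>x. (1 / \<phi> x) *\<^sub>R R x) et - L2_inner \<Omega> d et"
  shows "energy h e' p' + (h * (L2_inner \<Omega> (\<lambda>x. L x *v e' x) e' + L2_inner \<Omega> (\<lambda>x. L x *v et x) et) + 2 * h * D)
    \<le> (1 + h) * energy h e p + (h + h\<^sup>2) * (c * ((L2_norm \<Omega> R)\<^sup>2 + (L2_norm \<Omega> d)\<^sup>2))"
proof -
  let ?I = "\<lambda>f. LINT x|lebesgue_on \<Omega>. f x"
  define s1 where "s1 = (\<lambda>x. (1 / \<phi> x) *\<^sub>R e' x \<bullet> e' x)"
  define s2 where "s2 = (\<lambda>x. (L x *v e' x) \<bullet> e' x)"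
  define s4 where "s4 = (\<lambda>x. (shift_inv h x *v p' x) \<bullet> p' x)"
  define s5 where "s5 = (\<lambda>x. e' x \<bullet> p' x)"
  define t1 where "t1 = (\<lambda>x. (1 / \<phi> x) *\<^sub>R (et x - e x) \<bullet> et x)"
  define t2 where "t2 = (\<lambda>x. p x \<bullet> et x)"
  define t3 where "t3 = (\<lambda>x. (L x *v et x) \<bullet> et x)"
  define t4 where "t4 = (\<lambda>x. (1 / \<phi> x) *\<^sub>R R x \<bullet> et x)"
  define t5 where "t5 = (\<lambda>x. d x \<bullet> et x)"
  define t6 where "t6 = (\<lambda>x. (1 / \<phi> x) *\<^sub>R e x \<bullet> e x)"
  define t7 where "t7 = (\<lambda>x. (shift_inv h x *v p x) \<bullet> p x)"
  define t8 where "t8 = (\<lambda>x. (1 / \<phi> x) *\<^sub>R R x \<bullet> R x)"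
  define t9 where "t9 = (\<lambda>x. \<phi> x *\<^sub>R d x \<bullet> d x)"
  note defs = s1_def s2_def s4_def s5_def t1_def t2_def t3_def t4_def t5_def t6_def t7_def t8_def t9_def
  have [simp]: "integrable (lebesgue_on \<Omega>) s1" "integrable (lebesgue_on \<Omega>) s2"
    "integrable (lebesgue_on \<Omega>) s4" "integrable (lebesgue_on \<Omega>) s5"
    "integrable (lebesgue_on \<Omega>) t1" "integrable (lebesgue_on \<Omega>) t2"
    "integrable (lebesgue_on \<Omega>) t3" "integrable (lebesgue_on \<Omega>) t4"
    "integrable (lebesgue_on \<Omega>) t5" "integrable (lebesgue_on \<Omega>) t6"
    "integrable (lebesgue_on \<Omega>) t7" "integrable (lebesgue_on \<Omega>) t8"
    "integrable (lebesgue_on \<Omega>) t9"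
    unfolding defs
    by (intro L2_inner_integrable inverse_\<phi>_L2 \<phi>_L2 L_L2 shift_inv_L2 L2_diff L2 h)+
  have "?I (\<lambda>x. s1 x + h * s2 x + h * t3 x + h\<^sup>2 * s4 x + 2 * h * s5 x)
    \<le> ?I (\<lambda>x. 2 * t1 x + 2 * h * (t2 x + t3 x - (t4 x - t5 x)) + (1 + h) * (t6 x + h\<^sup>2 * t7 x)
        + (h + h\<^sup>2) * (t8 x + t9 x))"
  proof (rule integral_mono_AE)
    show "AE x in lebesgue_on \<Omega>. s1 x + h * s2 x + h * t3 x + h\<^sup>2 * s4 x + 2 * h * s5 x
      \<le> 2 * t1 x + 2 * h * (t2 x + t3 x - (t4 x - t5 x)) + (1 + h) * (t6 x + h\<^sup>2 * t7 x)
        + (h + h\<^sup>2) * (t8 x + t9 x)"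
      using update AE_domain
    proof eventually_elim
      case (elim x)
      have "0 < 1 / \<phi> x" using \<phi>_pos elim(2) by simp
      from energy_step_pointwise[OF this h L_symmetric[OF elim(2)] L_nonneg[OF elim(2)] elim(1),
          of "e x" "R x"]
      show ?case by (simp add: defs shift_inv_def inner_commute mult.commute)
    qed
  qed simp_all
  then have main: "?I s1 + h * ?I s2 + h * ?I t3 + h\<^sup>2 * ?I s4 + 2 * h * ?I s5
    \<le> 2 * ?I t1 + 2 * h * (?I t2 + ?I t3 - (?I t4 - ?I t5)) + (1 + h) * (?I t6 + h\<^sup>2 * ?I t7)
        + (h + h\<^sup>2) * (?I t8 + ?I t9)"
    by simp
  have "L2_inner \<Omega> (\<lambda>x. (1 / \<phi> x) *\<^sub>R ((et x - e x) /\<^sub>R h)) et = ?I t1 / h"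
    using L2_inner_scaleR_left[of \<Omega> "1 / h" "\<lambda>x. (1 / \<phi> x) *\<^sub>R (et x - e x)" et]
    by (simp add: L2_inner_def t1_def divide_inverse mult_ac)
  then have "D + ?I t1 / h + ?I t2 + ?I t3 = ?I t4 - ?I t5"
    using predictor by (simp add: L2_inner_def t2_def t3_def t4_def t5_def)
  then have "?I t1 = h * (?I t4 - ?I t5 - D - ?I t2 - ?I t3)"
    using h by (simp add: field_simps)
  \<comment> \<open>This is the predictor identity multiplied by \<open>2 * h\<close>: all terms
    containing \<open>et\<close> collapse into the stress dissipation, and the increment
    \<open>d\<close> of the pressure gradient disappears with them.\<close>
  then have "2 * ?I t1 + 2 * h * (?I t2 + ?I t3 - (?I t4 - ?I t5)) = - (2 * h * D)"
    by (simp add: algebra_simps)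
  moreover have "?I s5 = 0" using orthogonal by (simp add: s5_def L2_inner_def)
  moreover have "(h + h\<^sup>2) * (?I t8 + ?I t9) \<le> (h + h\<^sup>2) * (c * ((L2_norm \<Omega> R)\<^sup>2 + (L2_norm \<Omega> d)\<^sup>2))"
  proof (intro mult_left_mono)
    have "?I t8 \<le> c * (L2_norm \<Omega> R)\<^sup>2"
      using weighted_le[OF L2(7) inverse_\<phi>_L2[OF L2(7)]] \<phi>_bounds
      by (auto simp: t8_def L2_inner_def elim: eventually_mono)
    moreover have "?I t9 \<le> c * (L2_norm \<Omega> d)\<^sup>2"
      using weighted_le[OF L2(6) \<phi>_L2[OF L2(6)]] \<phi>_bounds
      by (auto simp: t9_def L2_inner_def elim: eventually_mono)
    ultimately show "?I t8 + ?I t9 \<le> c * ((L2_norm \<Omega> R)\<^sup>2 + (L2_norm \<Omega> d)\<^sup>2)"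
      by (simp add: distrib_left)
  qed (use h in simp)
  ultimately show ?thesis
    using main by (simp add: energy_def L2_inner_def s1_def s2_def s4_def t3_def t6_def t7_def algebra_simps)
qed

section \<open>Error equations of the scheme\<close>

lemma update_error:
  assumes h: "0 < h"
    and L2: "u1 \<in> L2 \<Omega>" "us \<in> L2 \<Omega>" "qn \<in> L2 \<Omega>"
    and upd: "gradient_update \<Omega> \<phi> L h us u1 qn q1"
  shows "AE x in lebesgue_on \<Omega>.
    (1 / \<phi> x) *\<^sub>R (((w x - u1 x) - (w x - us x)) /\<^sub>R h) + L x *v ((w x - u1 x) - (w x - us x))
      + ((g' x - q1 x) - (g x - qn x)) = g' x - g x"
proof -
  let ?A = "\<lambda>x. (1 / \<phi> x) *\<^sub>R ((u1 x - us x) /\<^sub>R h)" and ?B = "\<lambda>x. L x *v (u1 x - us x)"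
  have A: "?A \<in> L2 \<Omega>" and B: "?B \<in> L2 \<Omega>"
    by (intro inverse_\<phi>_L2 L_L2 L2_intros L2)+
  have q1: "q1 \<in> L2 \<Omega>" using upd by (simp add: gradient_update_def)
  have "AE x in lebesgue_on \<Omega>. q1 x = qn x - ?A x - ?B x"
    using upd q1 A B L2
    by (intro L2_eq_AE) (auto simp: gradient_update_def L2_inner_diff_left L2_intros)
  then show ?thesis
  proof eventually_elim
    case (elim x)
    \<comment> \<open>Both velocity errors refer to the same exact velocity, so their difference is
      the discrete correction with opposite sign; only the increment of the exact pressure gradient
      remains as a source.\<close>
    have "(w x - u1 x) - (w x - us x) = - (u1 x - us x)" by simp
    then show ?case
      unfolding elim by (simp add: matrix_vector_mult_diff_distrib algebra_simps)
  qed
qed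

text \<open>The projection only makes \<open>r = \<nabla>\<cdot>v\<close> orthogonal to \<open>W\<^sub>0\<close>, that is, constant; this suffices because
  the pressures have mean zero.\<close>

lemma discrete_gradient_orthogonal:
  assumes v: "has_div0 \<Omega> v r" "\<forall>w\<in>W0 \<Omega>. L2_inner \<Omega> r w = 0"
    and init: "has_grad \<Omega> \<Psi>0 G0" "\<Psi>0 \<in> W0 \<Omega>"
      "AE x in lebesgue_on \<Omega>. \<Psi>h 0 x = \<Psi>0 x" "AE x in lebesgue_on \<Omega>. qh 0 x = G0 x"
    and step: "\<And>n. n < N \<Longrightarrow> projection \<Omega> \<phi> L h (\<Psi>h n) (us (Suc n)) (uh (Suc n)) (\<Psi>h (Suc n))"
      "\<And>n. n < N \<Longrightarrow> gradient_update \<Omega> \<phi> L h (us (Suc n)) (uh (Suc n)) (qh n) (qh (Suc n))"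
  shows "n \<le> N \<Longrightarrow> L2_inner \<Omega> (qh n) v = 0 \<and> \<Psi>h n \<in> W0 \<Omega>"
proof (induction n)
  case 0
  have vL: "v \<in> L2 \<Omega>" using v(1) by (simp add: has_div0_def has_div_def)
  have GL: "G0 \<in> L2 \<Omega>" using init(1) by (simp add: has_grad_def)
  have qL: "qh 0 \<in> L2 \<Omega>"
    using init(4) by (intro L2_AE_cong[OF sets_domain GL]) (auto elim: eventually_mono)
  have "L2_inner \<Omega> (qh 0) v = L2_inner \<Omega> v G0"
    using L2_inner_cong_AE[OF qL GL vL init(4)] by (simp add: L2_inner_commute)
  also have "\<dots> = - L2_inner \<Omega> r \<Psi>0"
    using v(1) init(1) unfolding has_div0_def by (smt (verit))
  also have "\<dots> = 0" using v(2) init(2) by simp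
  finally have "L2_inner \<Omega> (qh 0) v = 0" .
  moreover have "AE x in lebesgue_on \<Omega>. \<Psi>0 x = \<Psi>h 0 x"
    using init(3) by eventually_elim simp
  ultimately show ?case using W0_AE_cong[OF sets_domain init(2)] by blast
next
  case (Suc n)
  then have IH: "L2_inner \<Omega> (qh n) v = 0" "\<Psi>h n \<in> W0 \<Omega>" and n: "n < N" by auto
  have vL: "v \<in> L2 \<Omega>" using v(1) by (simp add: has_div0_def has_div_def)
  have \<Psi>1: "\<Psi>h (Suc n) \<in> W0 \<Omega>" using step(1)[OF n] by (simp add: projection_def)
  \<comment> \<open>With the pressure term gone, the projection tested with the fixed field
    \<open>v\<close> says that the gradient update does not change the pairing of \<open>qh\<close>
    with \<open>v\<close>. Thus \<open>qh n\<close> need not be identified as a weak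
    gradient.\<close>
  have "L2_inner \<Omega> (\<lambda>x. \<Psi>h (Suc n) x - \<Psi>h n x) r = 0"
    using v(2) W0_diff[OF lmeasurable_domain \<Psi>1 IH(2)] by (subst L2_inner_commute) blast
  then have "L2_inner \<Omega> (\<lambda>x. (1 / \<phi> x) *\<^sub>R ((uh (Suc n) x - us (Suc n) x) /\<^sub>R h)) v
        + L2_inner \<Omega> (\<lambda>x. L x *v (uh (Suc n) x - us (Suc n) x)) v = 0"
    using step(1)[OF n] v(1) unfolding projection_def by fastforce
  moreover have "L2_inner \<Omega> (qh (Suc n)) v = L2_inner \<Omega> (qh n) v
        - L2_inner \<Omega> (\<lambda>x. (1 / \<phi> x) *\<^sub>R ((uh (Suc n) x - us (Suc n) x) /\<^sub>R h)) v
        - L2_inner \<Omega> (\<lambda>x. L x *v (uh (Suc n) x - us (Suc n) x)) v"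
    using step(2)[OF n] vL unfolding gradient_update_def by blast
  ultimately show ?case using IH(1) \<Psi>1 by simp
qed

text \<open>The stress equation is tested with the stress error and the momentum equation with
  \<open>ub - us\<close>. The predicted velocity lies only in L2, so integration by parts is applied
  to the exact velocity alone; for \<open>us\<close> the first predictor equation takes its
  place.\<close>

lemma predictor_error:
  assumes h: "0 < h" and \<nu>: "0 < \<nu>"
    and pred: "predictor \<Omega> \<nu> \<phi> L h un qn \<sigma>1 us"
    and L2: "ua \<in> L2 \<Omega>" "ub \<in> L2 \<Omega>" "ut \<in> L2 \<Omega>" "ga \<in> L2 \<Omega>" "gb \<in> L2 \<Omega>" "un \<in> L2 \<Omega>" "qn \<in> L2 \<Omega>"
    and grad: "has_vector_grad0 \<Omega> ub G"
    and flux: "AE x in lebesgue_on \<Omega>. \<sigma> x = - (\<nu> / \<phi> x) *\<^sub>R G x" "has_tensor_div \<Omega> \<sigma> d\<sigma>"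
    and momentum: "AE x in lebesgue_on \<Omega>. (1 / \<phi> x) *\<^sub>R ut x + gb x + d\<sigma> x + L x *v ub x = 0"
  shows "L2_inner \<Omega> (\<lambda>x. (\<phi> x / \<nu>) *\<^sub>R (\<sigma> x - \<sigma>1 x)) (\<lambda>x. \<sigma> x - \<sigma>1 x)
      + L2_inner \<Omega> (\<lambda>x. (1 / \<phi> x) *\<^sub>R (((ub x - us x) - (ua x - un x)) /\<^sub>R h)) (\<lambda>x. ub x - us x)
      + L2_inner \<Omega> (\<lambda>x. ga x - qn x) (\<lambda>x. ub x - us x)
      + L2_inner \<Omega> (\<lambda>x. L x *v (ub x - us x)) (\<lambda>x. ub x - us x)
    = L2_inner \<Omega> (\<lambda>x. (1 / \<phi> x) *\<^sub>R ((ub x - ua x) /\<^sub>R h - ut x)) (\<lambda>x. ub x - us x)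
      - L2_inner \<Omega> (\<lambda>x. gb x - ga x) (\<lambda>x. ub x - us x)"
proof -
  note \<Omega> = bounded_domain lmeasurable_domain
  obtain s where us: "us \<in> L2 \<Omega>" and s: "has_tensor_div \<Omega> \<sigma>1 s"
    and p1: "\<And>\<tau> r. has_tensor_div \<Omega> \<tau> r \<Longrightarrow>
      L2_inner \<Omega> (\<lambda>x. (\<phi> x / \<nu>) *\<^sub>R \<sigma>1 x) \<tau> - L2_inner \<Omega> us r = 0"
    and p2: "\<And>\<xi>. \<xi> \<in> L2 \<Omega> \<Longrightarrow> L2_inner \<Omega> (\<lambda>x. (1 / \<phi> x) *\<^sub>R ((us x - un x) /\<^sub>R h)) \<xi> + L2_inner \<Omega> s \<xi>
          + L2_inner \<Omega> qn \<xi> + L2_inner \<Omega> (\<lambda>x. L x *v us x) \<xi> = 0"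
    using pred unfolding predictor_def by blast
  let ?e = "\<lambda>x. ub x - us x" and ?\<tau> = "\<lambda>x. \<sigma> x - \<sigma>1 x"
  have e: "?e \<in> L2 \<Omega>" using L2 us by (intro L2_diff)
  have \<sigma>L: "\<sigma> \<in> L2 \<Omega>" "d\<sigma> \<in> L2 \<Omega>" and sL: "\<sigma>1 \<in> L2 \<Omega>" "s \<in> L2 \<Omega>"
    using has_tensor_div_L2 flux(2) s by blast+
  have \<tau>L: "?\<tau> \<in> L2 \<Omega>" using \<sigma>L sL by (intro L2_diff)
  have \<phi>\<nu>: "(\<lambda>x. (\<phi> x / \<nu>) *\<^sub>R f x) \<in> L2 \<Omega>" if "f \<in> L2 \<Omega>" for f :: "real ^ 'd \<Rightarrow> real ^ 'd ^ 'd"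
    using L2_scaleR[OF \<phi>_L2[OF that], of "1 / \<nu>"] by simp
  have \<tau>: "has_tensor_div \<Omega> ?\<tau> (\<lambda>x. d\<sigma> x - s x)"
    by (rule has_tensor_div_diff[OF \<Omega> flux(2) s])
  have "L2_inner \<Omega> (\<lambda>x. (\<phi> x / \<nu>) *\<^sub>R \<sigma> x) ?\<tau> = L2_inner \<Omega> (\<lambda>x. (-1) *\<^sub>R G x) ?\<tau>"
  proof (rule L2_inner_cong_AE[OF \<phi>\<nu>[OF \<sigma>L(1)] L2_scaleR \<tau>L])
    show "AE x in lebesgue_on \<Omega>. (\<phi> x / \<nu>) *\<^sub>R \<sigma> x = (-1) *\<^sub>R G x"
      using flux(1) AE_domain
    proof eventually_elim
      case (elim x)
      then show ?case using \<nu> \<phi>_pos[of x] by simp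
    qed
  qed (rule has_vector_grad0_L2[OF grad])
  also have "\<dots> = L2_inner \<Omega> ub (\<lambda>x. d\<sigma> x - s x)"
    using Green_tensor[OF \<Omega> grad \<tau>] L2_inner_scaleR_left[of \<Omega> "-1" G ?\<tau>] by simp
  finally have "L2_inner \<Omega> (\<lambda>x. (\<phi> x / \<nu>) *\<^sub>R \<sigma> x) ?\<tau> - L2_inner \<Omega> (\<lambda>x. (\<phi> x / \<nu>) *\<^sub>R \<sigma>1 x) ?\<tau>
      = L2_inner \<Omega> ub (\<lambda>x. d\<sigma> x - s x) - L2_inner \<Omega> us (\<lambda>x. d\<sigma> x - s x)"
    using p1[OF \<tau>] by simp
  then have D: "L2_inner \<Omega> (\<lambda>x. (\<phi> x / \<nu>) *\<^sub>R ?\<tau> x) ?\<tau> = L2_inner \<Omega> d\<sigma> ?e - L2_inner \<Omega> s ?e"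
    using \<phi>\<nu>[OF \<sigma>L(1)] \<phi>\<nu>[OF sL(1)] \<tau>L L2(2) us \<sigma>L sL e
    by (simp add: scaleR_diff_right L2_inner_diff_left[symmetric] L2_diff L2_inner_commute[of \<Omega> "?e"])
  have "L2_inner \<Omega> (\<lambda>x. (1 / \<phi> x) *\<^sub>R ut x + gb x + d\<sigma> x + L x *v ub x) ?e = 0"
    by (rule L2_inner_zero_AE[OF momentum])
  then have m: "L2_inner \<Omega> (\<lambda>x. (1 / \<phi> x) *\<^sub>R ut x) ?e + L2_inner \<Omega> gb ?e + L2_inner \<Omega> d\<sigma> ?e
      + L2_inner \<Omega> (\<lambda>x. L x *v ub x) ?e = 0"
    using L2 e \<sigma>L by (simp add: L2_inner_add_left L2_add inverse_\<phi>_L2 L_L2)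
  \<comment> \<open>Adding and subtracting \<open>ut\<close> isolates the consistency error of the
    backward difference.\<close>
  have A: "L2_inner \<Omega> (\<lambda>x. (1 / \<phi> x) *\<^sub>R ((?e x - (ua x - un x)) /\<^sub>R h)) ?e
      = L2_inner \<Omega> (\<lambda>x. (1 / \<phi> x) *\<^sub>R ((ub x - ua x) /\<^sub>R h - ut x)) ?e
        + L2_inner \<Omega> (\<lambda>x. (1 / \<phi> x) *\<^sub>R ut x) ?e
        - L2_inner \<Omega> (\<lambda>x. (1 / \<phi> x) *\<^sub>R ((us x - un x) /\<^sub>R h)) ?e"
  proof -
    have "L2_inner \<Omega> (\<lambda>x. (1 / \<phi> x) *\<^sub>R ((?e x - (ua x - un x)) /\<^sub>R h)) ?e
      = L2_inner \<Omega> (\<lambda>x. (1 / \<phi> x) *\<^sub>R ((ub x - ua x) /\<^sub>R h - ut x) + (1 / \<phi> x) *\<^sub>R ut x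
          - (1 / \<phi> x) *\<^sub>R ((us x - un x) /\<^sub>R h)) ?e"
      by (intro arg_cong[where f="\<lambda>f. L2_inner \<Omega> f ?e"] ext) (simp add: algebra_simps)
    also have "\<dots> = L2_inner \<Omega> (\<lambda>x. (1 / \<phi> x) *\<^sub>R ((ub x - ua x) /\<^sub>R h - ut x) + (1 / \<phi> x) *\<^sub>R ut x) ?e
        - L2_inner \<Omega> (\<lambda>x. (1 / \<phi> x) *\<^sub>R ((us x - un x) /\<^sub>R h)) ?e"
      by (intro L2_inner_diff_left inverse_\<phi>_L2 L2_intros L2 us)
    also have "L2_inner \<Omega> (\<lambda>x. (1 / \<phi> x) *\<^sub>R ((ub x - ua x) /\<^sub>R h - ut x) + (1 / \<phi> x) *\<^sub>R ut x) ?e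
        = L2_inner \<Omega> (\<lambda>x. (1 / \<phi> x) *\<^sub>R ((ub x - ua x) /\<^sub>R h - ut x)) ?e
        + L2_inner \<Omega> (\<lambda>x. (1 / \<phi> x) *\<^sub>R ut x) ?e"
      by (intro L2_inner_add_left inverse_\<phi>_L2 L2_intros L2 us)
    finally show ?thesis .
  qed
  have B: "L2_inner \<Omega> (\<lambda>x. L x *v ?e x) ?e = L2_inner \<Omega> (\<lambda>x. L x *v ub x) ?e - L2_inner \<Omega> (\<lambda>x. L x *v us x) ?e"
    using L2 us e by (simp add: matrix_vector_mult_diff_distrib L2_inner_diff_left L_L2)
  show ?thesis
    using D m A B p2[OF e] L2 e by (simp add: L2_inner_diff_left)
qed

end

section \<open>Convergence\<close>

theorem theorem4p3:
  fixes \<Omega> :: "(real ^ 'd) set" and M :: "(real ^ 'd) set set"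
    and \<nu> T :: real and \<phi> :: "real ^ 'd \<Rightarrow> real"
    and K Lhalf :: "real ^ 'd \<Rightarrow> real ^ 'd ^ 'd"
    and u0 :: "real ^ 'd \<Rightarrow> real ^ 'd" and \<Psi>0 :: "real ^ 'd \<Rightarrow> real"
    and u ut utt :: "real \<Rightarrow> real ^ 'd \<Rightarrow> real ^ 'd"
    and gu \<sigma> :: "real \<Rightarrow> real ^ 'd \<Rightarrow> real ^ 'd ^ 'd"
    and d\<sigma> :: "real \<Rightarrow> real ^ 'd \<Rightarrow> real ^ 'd"
    and \<Psi> :: "real \<Rightarrow> real ^ 'd \<Rightarrow> real"
    and g\<Psi> g\<Psi>t :: "real \<Rightarrow> real ^ 'd \<Rightarrow> real ^ 'd"
  assumes dim: "CARD('d) = 2 \<or> CARD('d) = 3"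
    and domain: "open \<Omega>" "connected \<Omega>" "\<Omega> \<noteq> {}" "bounded \<Omega>"
    and time: "0 < T"
    and viscosity: "0 < \<nu>"
    and porosity: "simplicial_partition M \<Omega>" "piecewise_constant M \<Omega> \<phi>" "\<forall>x\<in>\<Omega>. 0 < \<phi> x"
    and permeability: "K \<in> borel_measurable (lebesgue_on \<Omega>)" "\<forall>x\<in>\<Omega>. spd (K x)"
    and drag_bounded: "bounded (drag \<nu> K ` \<Omega>)"
    and drag_sqrt: "\<forall>x\<in>\<Omega>. spd (Lhalf x) \<and> Lhalf x ** Lhalf x = drag \<nu> K x"
    and solution: "brinkman_solution \<Omega> \<nu> \<phi> (drag \<nu> K) T u0 \<Psi>0 u ut gu \<sigma> d\<sigma> \<Psi> g\<Psi>"
    and smooth: "L2_C1 \<Omega> T u ut" "L2_C1 \<Omega> T ut utt" "L2_C1 \<Omega> T g\<Psi> g\<Psi>t"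
  shows "\<exists>C. \<forall>N \<sigma>h us uh \<Psi>h qh. 1 \<le> N \<longrightarrow>
    (let dt = T / real N; t = (\<lambda>n. real n * dt) in
      semi_discrete_solution \<Omega> \<nu> \<phi> (drag \<nu> K) dt N u0 \<Psi>0 (g\<Psi> 0) \<sigma>h us uh \<Psi>h qh \<longrightarrow>
      dt * (\<Sum>n<N. (1 / \<nu>) *
          (L2_norm \<Omega> (\<lambda>x. sqrt (\<phi> x) *\<^sub>R (\<sigma> (t (Suc n)) x - \<sigma>h (Suc n) x)))\<^sup>2)
      + (L2_norm \<Omega> (\<lambda>x. (1 / sqrt (\<phi> x)) *\<^sub>R (u (t N) x - uh N x)))\<^sup>2
      + dt\<^sup>2 * (L2_norm \<Omega> (\<lambda>x. sqrt (\<phi> x) *\<^sub>R (g\<Psi> (t N) x - qh N x)))\<^sup>2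
      + dt * (\<Sum>n<N.
          (L2_norm \<Omega> (\<lambda>x. Lhalf x *v (u (t (Suc n)) x - uh (Suc n) x)))\<^sup>2
          + (L2_norm \<Omega> (\<lambda>x. Lhalf x *v (u (t (Suc n)) x - us (Suc n) x)))\<^sup>2)
      \<le> C * dt\<^sup>2)"
proof -
  have \<Omega>l: "\<Omega> \<in> lmeasurable" using domain by (simp add: lmeasurable_open)
  then have \<Omega>s: "\<Omega> \<in> sets lebesgue" by (rule fmeasurableD)
  obtain c1 where c1: "0 < c1" "AE x in lebesgue_on \<Omega>. 0 < \<phi> x \<and> \<phi> x \<le> c1 \<and> 1 / \<phi> x \<le> c1"
    using piecewise_constant_bounds[OF porosity(1,2) \<Omega>s porosity(3)] by blast
  obtain c2 where c2: "0 < c2" "\<And>x v. x \<in> \<Omega> \<Longrightarrow> norm (drag \<nu> K x *v v) \<le> c2 * norm v"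
    using bounded_matrix_image[OF drag_bounded] by blast
  define c where "c = max c1 c2"
  \<comment> \<open>Symmetry and nonnegativity of the drag are read off from its symmetric square
    root.\<close>
  have Lhalf: "(Lhalf x *v v) \<bullet> (Lhalf x *v v) = (drag \<nu> K x *v v) \<bullet> v"
    and Ltrans: "transpose (drag \<nu> K x) = drag \<nu> K x" if x: "x \<in> \<Omega>" for x v
  proof -
    have s: "transpose (Lhalf x) = Lhalf x" and q: "drag \<nu> K x = Lhalf x ** Lhalf x"
      using drag_sqrt x by (auto simp: spd_def)
    show "(Lhalf x *v v) \<bullet> (Lhalf x *v v) = (drag \<nu> K x *v v) \<bullet> v"
      using symmetric_inner[OF s] by (simp add: q matrix_vector_mul_assoc[symmetric])
    show "transpose (drag \<nu> K x) = drag \<nu> K x" by (simp add: q matrix_transpose_mul s)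
  qed
  interpret brinkman_coefficients \<Omega> \<phi> "drag \<nu> K" c
  proof
    show "AE x in lebesgue_on \<Omega>. \<phi> x \<le> c \<and> 1 / \<phi> x \<le> c"
      using c1(2) by eventually_elim (auto simp: c_def)
    show "\<phi> \<in> borel_measurable (lebesgue_on \<Omega>)"
      by (rule piecewise_constant_measurable[OF porosity(1,2) \<Omega>s])
    have "(\<lambda>x. matrix_inv (K x)) \<in> borel_measurable (lebesgue_on \<Omega>)"
      using permeability by (intro borel_measurable_matrix_inv)
        (auto intro: spd_invertible simp: space_restrict_space)
    then show "drag \<nu> K \<in> borel_measurable (lebesgue_on \<Omega>)"
      unfolding drag_def by measurable
    fix x v assume x: "x \<in> \<Omega>"
    show "0 \<le> v \<bullet> (drag \<nu> K x *v v)" using Lhalf[OF x, of v] by (metis inner_commute inner_ge_zero)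
    show "norm (drag \<nu> K x *v v) \<le> c * norm v"
      using c2(2)[OF x, of v] mult_right_mono[of c2 c "norm v"] by (auto simp: c_def)
  qed (use domain \<Omega>l c1 c2 porosity Ltrans in \<open>auto simp: c_def\<close>)
  let ?L = "drag \<nu> K"
  have uL: "u t \<in> L2 \<Omega>" "ut t \<in> L2 \<Omega>" "g\<Psi> t \<in> L2 \<Omega>" if "t \<in> {0..T}" for t
    using smooth that by (auto simp: L2_C1_def L2_continuous_def)
  obtain B1 where B1: "0 \<le> B1" "\<And>a b. 0 \<le> a \<Longrightarrow> a \<le> b \<Longrightarrow> b \<le> T \<Longrightarrow>
      L2_norm \<Omega> (\<lambda>x. u b x - u a x - (b - a) *\<^sub>R ut b x) \<le> B1 * (b - a)\<^sup>2"
    using L2_C2_Taylor[OF smooth(1,2)] by blast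
  obtain B2 where B2: "0 \<le> B2" "\<And>a b. 0 \<le> a \<Longrightarrow> a \<le> b \<Longrightarrow> b \<le> T \<Longrightarrow>
      L2_norm \<Omega> (\<lambda>x. g\<Psi> b x - g\<Psi> a x) \<le> B2 * (b - a)"
    using L2_C1_increment[OF smooth(3)] by blast
  \<comment> \<open>One step has source at most \<open>h * h\<^sup>2 * K0\<close>: the remainder and
    the pressure increment are bounded by \<open>B1 * h\<close> and \<open>B2 * h\<close>, and
    \<open>h + h\<^sup>2 \<le> h * (1 + T)\<close>.\<close>
  define K0 where "K0 = (1 + T) * (c * (B1\<^sup>2 + B2\<^sup>2))"
  define \<kappa> where "\<kappa> = c * (c + T * c)"
  have K0: "0 \<le> K0" and \<kappa>: "0 \<le> \<kappa>" using time c_pos by (auto simp: K0_def \<kappa>_def)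
  show ?thesis
  \<comment> \<open>The summand \<open>1\<close> pays for velocity error and dissipation, and
    \<kappa> for changing the pressure weight to \<phi>.\<close>
  proof (intro exI[of _ "(1 + \<kappa>) * (T * K0 * exp T)"] allI impI)
    fix N :: nat and \<sigma>h :: "nat \<Rightarrow> real ^ 'd \<Rightarrow> real ^ 'd ^ 'd"
      and us uh :: "nat \<Rightarrow> real ^ 'd \<Rightarrow> real ^ 'd" and \<Psi>h :: "nat \<Rightarrow> real ^ 'd \<Rightarrow> real"
      and qh :: "nat \<Rightarrow> real ^ 'd \<Rightarrow> real ^ 'd"
    assume N: "1 \<le> N"
    define h where "h = T / real N"
    define t where "t = (\<lambda>n. real n * h)"
    have h: "0 < h" "h \<le> T" using N time by (auto simp: h_def field_simps)
    have tN: "t N = T" using N by (simp add: t_def h_def)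
    have tr: "t n \<in> {0..T}" if "n \<le> N" for n
    proof -
      have "0 \<le> t n" "t n \<le> t N" using that h(1) by (auto simp: t_def)
      then show ?thesis using tN by simp
    qed
    have tS: "t (Suc n) - t n = h" for n by (simp add: t_def algebra_simps)
    have "h * (\<Sum>n<N. (1 / \<nu>) *
          (L2_norm \<Omega> (\<lambda>x. sqrt (\<phi> x) *\<^sub>R (\<sigma> (t (Suc n)) x - \<sigma>h (Suc n) x)))\<^sup>2)
      + (L2_norm \<Omega> (\<lambda>x. (1 / sqrt (\<phi> x)) *\<^sub>R (u (t N) x - uh N x)))\<^sup>2
      + h\<^sup>2 * (L2_norm \<Omega> (\<lambda>x. sqrt (\<phi> x) *\<^sub>R (g\<Psi> (t N) x - qh N x)))\<^sup>2
      + h * (\<Sum>n<N.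
          (L2_norm \<Omega> (\<lambda>x. Lhalf x *v (u (t (Suc n)) x - uh (Suc n) x)))\<^sup>2
          + (L2_norm \<Omega> (\<lambda>x. Lhalf x *v (u (t (Suc n)) x - us (Suc n) x)))\<^sup>2)
      \<le> (1 + \<kappa>) * (T * K0 * exp T) * h\<^sup>2"
      if sd: "semi_discrete_solution \<Omega> \<nu> \<phi> ?L h N u0 \<Psi>0 (g\<Psi> 0) \<sigma>h us uh \<Psi>h qh"
    proof -
      have pred: "predictor \<Omega> \<nu> \<phi> ?L h (uh n) (qh n) (\<sigma>h (Suc n)) (us (Suc n))"
        and proj: "projection \<Omega> \<phi> ?L h (\<Psi>h n) (us (Suc n)) (uh (Suc n)) (\<Psi>h (Suc n))"
        and upd: "gradient_update \<Omega> \<phi> ?L h (us (Suc n)) (uh (Suc n)) (qh n) (qh (Suc n))"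
        if "n < N" for n using sd that by (auto simp: semi_discrete_solution_def)
      have u0: "AE x in lebesgue_on \<Omega>. u 0 x = uh 0 x"
        and q0: "AE x in lebesgue_on \<Omega>. g\<Psi> 0 x = qh 0 x"
        and \<Psi>0: "AE x in lebesgue_on \<Omega>. \<Psi>h 0 x = \<Psi> 0 x"
      proof -
        have "AE x in lebesgue_on \<Omega>. uh 0 x = u0 x" "AE x in lebesgue_on \<Omega>. u 0 x = u0 x"
          "AE x in lebesgue_on \<Omega>. \<Psi>h 0 x = \<Psi>0 x" "AE x in lebesgue_on \<Omega>. \<Psi> 0 x = \<Psi>0 x"
          "AE x in lebesgue_on \<Omega>. qh 0 x = g\<Psi> 0 x"
          using sd solution by (simp_all add: semi_discrete_solution_def brinkman_solution_def)
        note ae = this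
        show "AE x in lebesgue_on \<Omega>. u 0 x = uh 0 x" using ae(1,2) by eventually_elim simp
        show "AE x in lebesgue_on \<Omega>. \<Psi>h 0 x = \<Psi> 0 x" using ae(3,4) by eventually_elim simp
        show "AE x in lebesgue_on \<Omega>. g\<Psi> 0 x = qh 0 x" using ae(5) by eventually_elim simp
      qed
      have uhL: "uh n \<in> L2 \<Omega>" and qhL: "qh n \<in> L2 \<Omega>" if n: "n \<le> N" for n
      proof -
        have "uh n \<in> L2 \<Omega> \<and> qh n \<in> L2 \<Omega>"
        proof (cases n)
          case 0
          then show ?thesis
            using L2_AE_cong[OF \<Omega>s _ u0] L2_AE_cong[OF \<Omega>s _ q0] uL[of 0] time by simp
        next
          case (Suc m)
          then show ?thesis
            using n proj[of m] upd[of m]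
            by (auto simp: projection_def has_div0_def has_div_def gradient_update_def)
        qed
        then show "uh n \<in> L2 \<Omega>" "qh n \<in> L2 \<Omega>" by auto
      qed
      have usL: "us (Suc n) \<in> L2 \<Omega>" if "n < N" for n
        using pred[OF that] by (simp add: predictor_def)
      have div_u: "has_div0 \<Omega> (u s) (\<lambda>x. 0)" if "s \<in> {0..T}" for s
        using solution that bounded_domain \<Omega>l
        by (intro has_div0_trace_zero[of \<Omega> _ "gu s"]) (auto simp: brinkman_solution_def)
      have g\<Psi>: "has_grad \<Omega> (\<Psi> s) (g\<Psi> s)" "\<Psi> s \<in> W0 \<Omega>" if "s \<in> {0..T}" for s
        using solution that by (auto simp: brinkman_solution_def)
      have zero: "\<forall>w\<in>W0 \<Omega>. L2_inner \<Omega> (\<lambda>x. 0) w = 0" by simp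
      have orth: "L2_inner \<Omega> (\<lambda>x. u (t (Suc n)) x - uh (Suc n) x)
          (\<lambda>x. g\<Psi> (t (Suc n)) x - qh (Suc n) x) = 0" if n: "n < N" for n
      proof -
        have t1: "t (Suc n) \<in> {0..T}" using n by (intro tr) simp
        obtain r where r: "has_div0 \<Omega> (uh (Suc n)) r" "\<forall>w\<in>W0 \<Omega>. L2_inner \<Omega> r w = 0"
          using proj[OF n] unfolding projection_def by blast
        \<comment> \<open>Expanding the product of errors gives four pairings of a velocity with a
          pressure gradient. This claim, used for the exact velocity and for
          \<open>uh (Suc n)\<close>, makes each of them vanish.\<close>
        have *: "L2_inner \<Omega> (qh (Suc n)) v = 0 \<and> L2_inner \<Omega> (g\<Psi> (t (Suc n))) v = 0"
          if v: "has_div0 \<Omega> v r" "\<forall>w\<in>W0 \<Omega>. L2_inner \<Omega> r w = 0" for v r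
        proof
          have "AE x in lebesgue_on \<Omega>. qh 0 x = g\<Psi> 0 x" using q0 by eventually_elim simp
          then show "L2_inner \<Omega> (qh (Suc n)) v = 0"
            using discrete_gradient_orthogonal[where N=N and n="Suc n", OF v g\<Psi> \<Psi>0 _ proj upd]
              n time by auto
          show "L2_inner \<Omega> (g\<Psi> (t (Suc n))) v = 0"
            using v g\<Psi>[OF t1] unfolding has_div0_def
            by (subst L2_inner_commute) (metis add.right_neutral)
        qed
        have "uh (Suc n) \<in> L2 \<Omega>" "qh (Suc n) \<in> L2 \<Omega>" using n by (auto intro: uhL qhL)
        then show ?thesis
          using *[OF div_u[OF t1] zero] *[OF r] uL[OF t1]
          by (simp add: L2_inner_diff_left L2_inner_diff_right L2_diff
              L2_inner_commute[of \<Omega> "u (t (Suc n))"] L2_inner_commute[of \<Omega> "uh (Suc n)"])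
      qed
      define e where "e = (\<lambda>n x. u (t n) x - uh n x)"
      define p where "p = (\<lambda>n x. g\<Psi> (t n) x - qh n x)"
      \<comment> \<open>Index shift: \<open>et n\<close> belongs to level \<open>Suc n\<close>,
        while \<open>e n\<close> and \<open>p n\<close> belong to level \<open>n\<close>.\<close>
      define et where "et = (\<lambda>n x. u (t (Suc n)) x - us (Suc n) x)"
      define Dn where "Dn = (\<lambda>n. L2_inner \<Omega> (\<lambda>x. (\<phi> x / \<nu>) *\<^sub>R (\<sigma> (t (Suc n)) x - \<sigma>h (Suc n) x))
          (\<lambda>x. \<sigma> (t (Suc n)) x - \<sigma>h (Suc n) x))"
      define Q where "Q = (\<lambda>n. L2_inner \<Omega> (\<lambda>x. ?L x *v e (Suc n) x) (e (Suc n))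
          + L2_inner \<Omega> (\<lambda>x. ?L x *v et n x) (et n))"
      have eL: "e n \<in> L2 \<Omega>" "p n \<in> L2 \<Omega>" if "n \<le> N" for n
        unfolding e_def p_def using that by (intro L2_diff uL tr uhL qhL; simp)+
      have step: "energy h (e (Suc n)) (p (Suc n)) + (h * Q n + 2 * h * Dn n)
          \<le> (1 + h) * energy h (e n) (p n) + h * h\<^sup>2 * K0" if n: "n < N" for n
      proof -
        let ?a = "t n" and ?b = "t (Suc n)"
        have ab: "?a \<in> {0..T}" "?b \<in> {0..T}" "?b \<in> {0<..T}" "?a \<le> ?b"
          using tr[of n] tr[of "Suc n"] n h(1) by (auto simp: t_def)
        let ?R = "\<lambda>x. (u ?b x - u ?a x) /\<^sub>R h - ut ?b x"
        let ?d = "\<lambda>x. g\<Psi> ?b x - g\<Psi> ?a x"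
        have L2n: "uh n \<in> L2 \<Omega>" "uh (Suc n) \<in> L2 \<Omega>" "qh n \<in> L2 \<Omega>" "us (Suc n) \<in> L2 \<Omega>"
          using n by (auto intro: uhL qhL usL)
        have sol: "has_vector_grad0 \<Omega> (u ?b) (gu ?b)"
          "AE x in lebesgue_on \<Omega>. \<sigma> ?b x = - (\<nu> / \<phi> x) *\<^sub>R gu ?b x"
          "has_tensor_div \<Omega> (\<sigma> ?b) (d\<sigma> ?b)"
          "AE x in lebesgue_on \<Omega>. (1 / \<phi> x) *\<^sub>R ut ?b x + g\<Psi> ?b x + d\<sigma> ?b x + ?L x *v u ?b x = 0"
          using solution ab(2,3) unfolding brinkman_solution_def by blast+
        have "energy h (e (Suc n)) (p (Suc n)) + (h * Q n + 2 * h * Dn n)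
          \<le> (1 + h) * energy h (e n) (p n) + (h + h\<^sup>2) * (c * ((L2_norm \<Omega> ?R)\<^sup>2 + (L2_norm \<Omega> ?d)\<^sup>2))"
          unfolding Q_def
        proof (rule energy_step[OF h(1)])
          show "e n \<in> L2 \<Omega>" "e (Suc n) \<in> L2 \<Omega>" "p n \<in> L2 \<Omega>" "p (Suc n) \<in> L2 \<Omega>"
            using n by (auto intro: eL)
          show "et n \<in> L2 \<Omega>" unfolding et_def by (intro L2_diff uL ab L2n)
          show "?d \<in> L2 \<Omega>" "?R \<in> L2 \<Omega>" by (intro L2_intros uL ab)+
          show "AE x in lebesgue_on \<Omega>. (1 / \<phi> x) *\<^sub>R ((e (Suc n) x - et n x) /\<^sub>R h)
              + ?L x *v (e (Suc n) x - et n x) + (p (Suc n) x - p n x) = ?d x"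
            unfolding e_def et_def p_def by (rule update_error[OF h(1) L2n(2,4,3) upd[OF n]])
          show "L2_inner \<Omega> (e (Suc n)) (p (Suc n)) = 0"
            unfolding e_def p_def by (rule orth[OF n])
          show "Dn n + L2_inner \<Omega> (\<lambda>x. (1 / \<phi> x) *\<^sub>R ((et n x - e n x) /\<^sub>R h)) (et n)
              + L2_inner \<Omega> (p n) (et n) + L2_inner \<Omega> (\<lambda>x. ?L x *v et n x) (et n)
              = L2_inner \<Omega> (\<lambda>x. (1 / \<phi> x) *\<^sub>R ?R x) (et n) - L2_inner \<Omega> ?d (et n)"
            unfolding Dn_def e_def et_def p_def
            by (rule predictor_error[OF h(1) viscosity pred[OF n] uL(1)[OF ab(1)] uL(1,2)[OF ab(2)]
                uL(3)[OF ab(1)] uL(3)[OF ab(2)] L2n(1,3) sol])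
        qed
        also have "(h + h\<^sup>2) * (c * ((L2_norm \<Omega> ?R)\<^sup>2 + (L2_norm \<Omega> ?d)\<^sup>2)) \<le> h * h\<^sup>2 * K0"
        proof -
          \<comment> \<open>\<open>?R\<close> is the second order Taylor remainder divided by
            \<open>h\<close>, hence of order \<open>h\<close>.\<close>
          have "?R = (\<lambda>x. (1 / h) *\<^sub>R (u ?b x - u ?a x - (?b - ?a) *\<^sub>R ut ?b x))"
            using h(1) by (simp add: tS fun_eq_iff scaleR_diff_right divide_inverse)
          then have "L2_norm \<Omega> ?R = (1 / h) * L2_norm \<Omega> (\<lambda>x. u ?b x - u ?a x - (?b - ?a) *\<^sub>R ut ?b x)"
            using h(1) by (simp only: L2_norm_def L2_inner_scaleR_left L2_inner_scaleR_right)
              (simp add: real_sqrt_mult real_sqrt_divide)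
          also have "\<dots> \<le> (1 / h) * (B1 * h\<^sup>2)"
            using B1(2)[of ?a ?b] ab h(1) tS[of n] by (intro mult_left_mono) auto
          also have "\<dots> = B1 * h" using h(1) by (simp add: power2_eq_square)
          finally have "(L2_norm \<Omega> ?R)\<^sup>2 \<le> (B1 * h)\<^sup>2"
            by (intro power_mono L2_norm_nonneg)
          moreover have "(L2_norm \<Omega> ?d)\<^sup>2 \<le> (B2 * h)\<^sup>2"
            using B2(2)[of ?a ?b] ab tS[of n] by (intro power_mono L2_norm_nonneg) auto
          ultimately have "c * ((L2_norm \<Omega> ?R)\<^sup>2 + (L2_norm \<Omega> ?d)\<^sup>2) \<le> c * ((B1 * h)\<^sup>2 + (B2 * h)\<^sup>2)"
            using c_pos by (intro mult_left_mono add_mono) auto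
          moreover have "h + h\<^sup>2 \<le> h * (1 + T)"
            using h by (simp add: power2_eq_square distrib_left)
          ultimately have "(h + h\<^sup>2) * (c * ((L2_norm \<Omega> ?R)\<^sup>2 + (L2_norm \<Omega> ?d)\<^sup>2))
              \<le> (h * (1 + T)) * (c * ((B1 * h)\<^sup>2 + (B2 * h)\<^sup>2))"
            using h c_pos time by (intro mult_mono) auto
          also have "\<dots> = h * h\<^sup>2 * K0"
            by (simp add: K0_def power_mult_distrib algebra_simps)
          finally show ?thesis .
        qed
        finally show ?thesis by simp
      qed
      have \<sigma>sq: "(1 / \<nu>) * (L2_norm \<Omega> (\<lambda>x. sqrt (\<phi> x) *\<^sub>R (\<sigma> (t (Suc n)) x - \<sigma>h (Suc n) x)))\<^sup>2 = Dn n" for n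
      proof -
        have "L2_inner \<Omega> (\<lambda>x. sqrt (\<phi> x) *\<^sub>R (\<sigma> (t (Suc n)) x - \<sigma>h (Suc n) x))
            (\<lambda>x. sqrt (\<phi> x) *\<^sub>R (\<sigma> (t (Suc n)) x - \<sigma>h (Suc n) x))
          = (LINT x|lebesgue_on \<Omega>. \<nu> * ((\<phi> x / \<nu>) *\<^sub>R (\<sigma> (t (Suc n)) x - \<sigma>h (Suc n) x)
              \<bullet> (\<sigma> (t (Suc n)) x - \<sigma>h (Suc n) x)))"
          unfolding L2_inner_def
          using viscosity \<phi>_pos
          by (intro Bochner_Integration.integral_cong refl)
            (auto simp: mult.assoc[symmetric] less_imp_le)
        then show ?thesis
          using viscosity by (simp add: L2_norm_squared Dn_def L2_inner_def)
      qed
      have esq: "(L2_norm \<Omega> (\<lambda>x. (1 / sqrt (\<phi> x)) *\<^sub>R e n x))\<^sup>2 = L2_inner \<Omega> (\<lambda>x. (1 / \<phi> x) *\<^sub>R e n x) (e n)" for n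
        unfolding L2_norm_squared L2_inner_def using \<phi>_pos
        by (intro Bochner_Integration.integral_cong refl) (auto simp: mult.assoc[symmetric] less_imp_le)
      have psq: "(L2_norm \<Omega> (\<lambda>x. sqrt (\<phi> x) *\<^sub>R p n x))\<^sup>2 = L2_inner \<Omega> (\<lambda>x. \<phi> x *\<^sub>R p n x) (p n)" for n
        unfolding L2_norm_squared L2_inner_def using \<phi>_pos
        by (intro Bochner_Integration.integral_cong refl) (auto simp: mult.assoc[symmetric] less_imp_le)
      have Lsq: "(L2_norm \<Omega> (\<lambda>x. Lhalf x *v w x))\<^sup>2 = L2_inner \<Omega> (\<lambda>x. ?L x *v w x) w" for w
        unfolding L2_norm_squared L2_inner_def using Lhalf
        by (intro Bochner_Integration.integral_cong refl) auto
      have Dn: "0 \<le> Dn n" for n unfolding \<sigma>sq[symmetric] using viscosity by simp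
      have Q: "0 \<le> Q n" for n unfolding Q_def Lsq[symmetric] by simp
      have E0: "energy h (e 0) (p 0) = 0"
      proof -
        have "AE x in lebesgue_on \<Omega>. (1 / \<phi> x) *\<^sub>R e 0 x = 0"
          using u0 by eventually_elim (simp add: e_def t_def)
        moreover have "AE x in lebesgue_on \<Omega>. shift_inv h x *v p 0 x = 0"
          using q0 by eventually_elim (simp add: p_def t_def)
        ultimately show ?thesis by (simp add: energy_def L2_inner_zero_AE)
      qed
      \<comment> \<open>Summing \<open>N\<close> sources of order \<open>h\<close> cubed costs one
        power of \<open>h\<close>, as \<open>real N * h = T\<close>; the initial energy is zero
        because the scheme starts from exact data.\<close>
      have "energy h (e N) (p N) + (\<Sum>n<N. h * Q n + 2 * h * Dn n)
          \<le> real N * (h * h\<^sup>2 * K0) * exp (real N * h)"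
        by (rule discrete_Gronwall[where F="\<lambda>n. energy h (e n) (p n)", OF step])
          (use h(1) Q Dn E0 K0 in auto)
      also have "\<dots> = T * K0 * exp T * h\<^sup>2"
        using tN by (simp add: t_def algebra_simps)
      finally have main: "energy h (e N) (p N) + (\<Sum>n<N. h * Q n + 2 * h * Dn n) \<le> T * K0 * exp T * h\<^sup>2" .
      let ?P = "L2_inner \<Omega> (\<lambda>x. shift_inv h x *v p N x) (p N)"
      have eN: "0 \<le> L2_inner \<Omega> (\<lambda>x. (1 / \<phi> x) *\<^sub>R e N x) (e N)" unfolding esq[symmetric] by simp
      have PN: "0 \<le> ?P"
        unfolding L2_inner_def
        by (rule Bochner_Integration.integral_nonneg)
          (use spd_inv_nonneg[OF shifted_facts(1)[OF h(1)]] in \<open>auto simp: shift_inv_def inner_commute\<close>)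
      have sumQ: "(\<Sum>n<N. h * Q n + 2 * h * Dn n) = h * (\<Sum>n<N. Q n) + 2 * (h * (\<Sum>n<N. Dn n))"
        by (simp add: sum.distrib sum_distrib_left mult.assoc)
      have Sn: "0 \<le> h * (\<Sum>n<N. Q n)" "0 \<le> h * (\<Sum>n<N. Dn n)"
        using h(1) Q Dn by (auto intro!: mult_nonneg_nonneg sum_nonneg)
      have "h\<^sup>2 * L2_inner \<Omega> (\<lambda>x. \<phi> x *\<^sub>R p N x) (p N) \<le> h\<^sup>2 * (\<kappa> * ?P)"
      proof (intro mult_left_mono order_trans[OF pressure_weight_bound[OF h(1) eL(2)]])
        show "c * (c + h * c) * ?P \<le> \<kappa> * ?P"
          unfolding \<kappa>_def using PN h c_pos by (intro mult_right_mono mult_left_mono add_left_mono) auto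
      qed auto
      also have "\<dots> = \<kappa> * (h\<^sup>2 * ?P)" by simp
      also have "\<dots> \<le> \<kappa> * (T * K0 * exp T * h\<^sup>2)"
        using main sumQ Sn eN \<kappa> by (intro mult_left_mono) (auto simp: energy_def)
      finally have pN: "h\<^sup>2 * L2_inner \<Omega> (\<lambda>x. \<phi> x *\<^sub>R p N x) (p N) \<le> \<kappa> * (T * K0 * exp T * h\<^sup>2)" .
      \<comment> \<open>Dropping this term and one of the two copies of the stress sum from
        \<open>main\<close>, then adding \<open>pN\<close>, leaves exactly the quantities of the
        estimate.\<close>
      have "0 \<le> h\<^sup>2 * ?P" using PN by simp
      then have "h * (\<Sum>n<N. Dn n) + L2_inner \<Omega> (\<lambda>x. (1 / \<phi> x) *\<^sub>R e N x) (e N)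
          + h\<^sup>2 * L2_inner \<Omega> (\<lambda>x. \<phi> x *\<^sub>R p N x) (p N) + h * (\<Sum>n<N. Q n)
          \<le> (1 + \<kappa>) * (T * K0 * exp T) * h\<^sup>2"
        using main sumQ Sn pN by (simp add: energy_def algebra_simps)
      then show ?thesis
        using esq[of N] psq[of N] by (simp only: \<sigma>sq Lsq Q_def e_def et_def p_def)
    qed
    then show "let dt = T / real N; t = (\<lambda>n. real n * dt) in
      semi_discrete_solution \<Omega> \<nu> \<phi> ?L dt N u0 \<Psi>0 (g\<Psi> 0) \<sigma>h us uh \<Psi>h qh \<longrightarrow>
      dt * (\<Sum>n<N. (1 / \<nu>) *
          (L2_norm \<Omega> (\<lambda>x. sqrt (\<phi> x) *\<^sub>R (\<sigma> (t (Suc n)) x - \<sigma>h (Suc n) x)))\<^sup>2)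
      + (L2_norm \<Omega> (\<lambda>x. (1 / sqrt (\<phi> x)) *\<^sub>R (u (t N) x - uh N x)))\<^sup>2
      + dt\<^sup>2 * (L2_norm \<Omega> (\<lambda>x. sqrt (\<phi> x) *\<^sub>R (g\<Psi> (t N) x - qh N x)))\<^sup>2
      + dt * (\<Sum>n<N.
          (L2_norm \<Omega> (\<lambda>x. Lhalf x *v (u (t (Suc n)) x - uh (Suc n) x)))\<^sup>2
          + (L2_norm \<Omega> (\<lambda>x. Lhalf x *v (u (t (Suc n)) x - us (Suc n) x)))\<^sup>2)
      \<le> (1 + \<kappa>) * (T * K0 * exp T) * dt\<^sup>2"
      unfolding Let_def h_def t_def by blast
  qed
qed

end
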